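(* Let $l\geq 1$ be an integer. Let $T_1,\ldots,T_l:X\rightarrow X$ be commuting, invertible, measure-preserving transformations of a probability space $(X,\mathcal{B},\mu)$. Then for any $f_1,\ldots,f_l\in L^\infty(X,\mathcal{B},\mu)$, the averages $$A_N(f_1,\ldots,f_l)(x):=\frac{1}{N}\sum_{n=1}^N f_1(T_1^n x)\cdots f_l(T_l^n x)$$ converge in $L^2(X,\mathcal{B},\mu)$ as $N\to\infty$. *)

theory Defs
  imports "HOL-Probability.Probability"
begin

text \<open>
  Points outside \<^term>\<open>space M\<close> carry no information: maps and functions are only looked at
  on \<^term>\<open>space M\<close>.  Elements of the Lebesgue spaces are represented by measurable functions
  rather than by their classes modulo null sets.
\<close>

definition measure_preserving_on :: "'a measure \<Rightarrow> ('a \<Rightarrow> 'a) \<Rightarrow> bool" where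
  "measure_preserving_on M T \<longleftrightarrow>
     T \<in> measurable M M \<and>
     (\<forall>A\<in>sets M. emeasure M (T -` A \<inter> space M) = emeasure M A)"

text \<open>Invertible in the category of measurable spaces: the inverse is measurable as well.\<close>

definition invertible_on :: "'a measure \<Rightarrow> ('a \<Rightarrow> 'a) \<Rightarrow> bool" where
  "invertible_on M T \<longleftrightarrow>
     T \<in> measurable M M \<and>
     (\<exists>S\<in>measurable M M. \<forall>x\<in>space M. S (T x) = x \<and> T (S x) = x)"

definition L_infinity :: "'a measure \<Rightarrow> ('a \<Rightarrow> complex) set" where
  "L_infinity M = {f \<in> borel_measurable M. \<exists>C::real. AE x in M. norm (f x) \<le> C}"

definition L_two :: "'a measure \<Rightarrow> ('a \<Rightarrow> complex) set" where
  "L_two M = {f \<in> borel_measurable M. integrable M (\<lambda>x. (norm (f x))\<^sup>2)}"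

definition L_two_norm :: "'a measure \<Rightarrow> ('a \<Rightarrow> complex) \<Rightarrow> real" where
  "L_two_norm M f = sqrt (\<integral>x. (norm (f x))\<^sup>2 \<partial>M)"

text \<open>
  Membership of every term in \<^term>\<open>L_two M\<close> is part of the definition, since the Bochner
  integral in \<^term>\<open>L_two_norm M f\<close> is 0 by convention when \<^term>\<open>f\<close> is not square integrable.
\<close>

definition converges_in_L_two :: "'a measure \<Rightarrow> (nat \<Rightarrow> 'a \<Rightarrow> complex) \<Rightarrow> bool" where
  "converges_in_L_two M F \<longleftrightarrow>
     (\<forall>N. F N \<in> L_two M) \<and>
     (\<exists>g\<in>L_two M. (\<lambda>N. L_two_norm M (\<lambda>x. F N x - g x)) \<longlonglongrightarrow> 0)"

definition multiple_ergodic_average ::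
  "nat \<Rightarrow> (nat \<Rightarrow> 'a \<Rightarrow> 'a) \<Rightarrow> (nat \<Rightarrow> 'a \<Rightarrow> complex) \<Rightarrow> nat \<Rightarrow> 'a \<Rightarrow> complex" where
  "multiple_ergodic_average l T f N x =
     (\<Sum>n=1..N. \<Prod>i=1..l. f i ((T i ^^ n) x)) / of_nat N"

end

theory Submission
  imports Defs "HOL-Library.Function_Algebras"
begin

text \<open>
  The proof is by induction on the number of transformations, in the spirit of Walsh, but with an
  ultraproduct in place of quantitative bounds.  The induction hypothesis concerns sequences (in
  \<open>s\<close>) of finite families (in \<open>w < k s\<close>) of bounded functions, with the seminorm obtained by
  averaging over the family and passing to the limit along a fixed filter \<open>U\<close> on the naturals.

  Fix all functions but the last.  The last functions for which the averages are Cauchy form a linear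
  space \<open>V\<close>.  Subtract from the given last function an element of \<open>V\<close> almost minimizing the distance;
  the remainder \<open>u\<close> is almost orthogonal to \<open>V\<close>.  If the averages of \<open>u\<close> did not become small, one
  could choose lengths \<open>N s\<close>, tending to infinity along \<open>U\<close>, at which they are large, and by duality
  \<open>u\<close> would correlate with a function \<open>\<sigma>\<close>, an average of length \<open>N s\<close>.  For fixed \<open>l\<close>, shifting \<open>\<sigma>\<close>
  by the \<open>l\<close>-th power of the last transformation only translates this average, so the averages of
  \<open>\<sigma>\<close> are averages over a family of size \<open>k s * N s\<close> involving one transformation less.  By the
  induction hypothesis \<open>\<sigma>\<close> lies in \<open>V\<close>, a contradiction.
\<close>

subsection \<open>Limits along a filter and elementary averages\<close>

lemma ex_filter_bounded_convergent:
  obtains U :: "nat filter"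
  where "U \<noteq> bot" "U \<le> sequentially"
    "\<And>f :: nat \<Rightarrow> real. bounded (range f) \<Longrightarrow> \<exists>L. (f \<longlongrightarrow> L) U"
proof -
  \<comment> \<open>By Tychonoff, the points \<open>e s\<close> (all bounded sequences evaluated at \<open>s\<close>) have a cluster point \<open>x\<close>,
    and \<open>U\<close> collects the indices at which \<open>e\<close> is close to \<open>x\<close>.\<close>
  define K :: "(nat \<Rightarrow> real) \<Rightarrow> real set"
    where "K f = (if bounded (range f) then closure (range f) else {0})" for f
  define e :: "nat \<Rightarrow> (nat \<Rightarrow> real) \<Rightarrow> real"
    where "e s f = (if bounded (range f) then f s else 0)" for s f
  have "compact (K f)" for f
    by (simp add: K_def compact_closure)
  then have "compactin (product_topology (\<lambda>_. euclidean) UNIV) (PiE UNIV K)"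
    by (simp add: compactin_PiE)
  then have comp: "compact (PiE UNIV K)"
    by (simp add: euclidean_product_topology)
  have "e s f \<in> K f" for s f
    by (simp add: e_def K_def closure_subset[THEN subsetD])
  then have "eventually (\<lambda>x. x \<in> PiE UNIV K) (filtermap e sequentially)"
    by (simp add: eventually_filtermap PiE_UNIV_domain)
  moreover have "filtermap e sequentially \<noteq> bot"
    by (simp add: filtermap_bot_iff)
  ultimately obtain x where x: "inf (nhds x) (filtermap e sequentially) \<noteq> bot"
    using comp unfolding compact_filter by blast
  define U where "U = inf sequentially (filtercomap e (nhds x))"
  have "U \<noteq> bot"
  proof
    \<comment> \<open>If \<open>U\<close> were trivial, some neighbourhood of \<open>x\<close> would
      contain no \<open>e s\<close> with \<open>s\<close> large, and \<open>x\<close> would not be a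
      cluster point.\<close>
    assume "U = bot"
    then obtain P Q where "eventually P sequentially" "eventually Q (nhds x)"
      and PQ: "\<And>s. \<not> (P s \<and> Q (e s))"
      unfolding U_def trivial_limit_def eventually_inf eventually_filtercomap by metis
    then have "eventually (\<lambda>y. \<not> Q y) (filtermap e sequentially)"
      by (auto simp: eventually_filtermap elim: eventually_mono)
    with \<open>eventually Q (nhds x)\<close> have "eventually (\<lambda>_. False) (inf (nhds x) (filtermap e sequentially))"
      unfolding eventually_inf by blast
    with x show False by (simp add: trivial_limit_def)
  qed
  moreover have "U \<le> sequentially" by (simp add: U_def)
  moreover have "\<exists>L. (f \<longlongrightarrow> L) U" if "bounded (range f)" for f :: "nat \<Rightarrow> real"
  proof -
    have "(e \<longlongrightarrow> x) (filtercomap e (nhds x))"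
      by (rule filterlim_filtercomap)
    then have "(e \<longlongrightarrow> x) U"
      unfolding U_def by (rule tendsto_mono[rotated]) simp
    then have "((\<lambda>s. e s f) \<longlongrightarrow> x f) U"
      by (rule continuous_on_tendsto_compose[OF continuous_on_product_coordinates]) simp_all
    with that show ?thesis by (auto simp: e_def)
  qed
  ultimately show ?thesis using that by blast
qed

text \<open>Each further unit shift changes the sum by two boundary terms, each at most
  \<open>C\<close>. The bound is free of \<open>N\<close>, so after division by a large
  \<open>N\<close> the shift is negligible.\<close>

lemma sum_shift_diff_le:
  fixes a :: "nat \<Rightarrow> real"
  assumes "\<And>n. \<bar>a n\<bar> \<le> C"
  shows "\<bar>(\<Sum>n=1..N. a n) - (\<Sum>n=1..N. a (n + l))\<bar> \<le> 2 * l * C"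
proof (induction l)
  case (Suc l)
  have "(\<Sum>n=1..N. a (n + l)) - (\<Sum>n=1..N. a (n + Suc l)) = a (1 + l) - a (N + Suc l)"
    by (induction N) auto
  moreover have "\<bar>a (1 + l) - a (N + Suc l)\<bar> \<le> 2 * C"
    using assms[of "1 + l"] assms[of "N + Suc l"] by linarith
  ultimately show ?case using Suc by (simp add: algebra_simps)
qed simp

lemma average_square_le:
  fixes a :: "nat \<Rightarrow> real"
  shows "((\<Sum>n=1..N. a n) / N)\<^sup>2 \<le> (\<Sum>n=1..N. (a n)\<^sup>2) / N"
proof -
  have "(\<Sum>n=1..N. a n)\<^sup>2 \<le> (\<Sum>n=1..N. (a n)\<^sup>2) * N"
    using sum_squared_le_sum_of_squares[of a "{1..N}"] by simp
  then show ?thesis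
    by (cases "N = 0") (simp_all add: field_simps power2_eq_square)
qed

lemma average_abs_le:
  fixes a :: "nat \<Rightarrow> real"
  assumes "\<And>n. n \<in> {1..N} \<Longrightarrow> \<bar>a n\<bar> \<le> C" "0 \<le> C"
  shows "\<bar>(\<Sum>n=1..N. a n) / N\<bar> \<le> C"
proof -
  have "\<bar>\<Sum>n=1..N. a n\<bar> \<le> (\<Sum>n=1..N. C)"
    by (rule order_trans[OF sum_abs sum_mono]) (use assms(1) in auto)
  then have "\<bar>\<Sum>n=1..N. a n\<bar> \<le> N * C" by simp
  then show ?thesis using assms(2)
    by (cases "N = 0") (simp_all add: field_simps)
qed

subsection \<open>Internal functions and their trace\<close>

text \<open>Stands in for a nonprincipal ultrafilter: of its properties only the existence of limits
  of bounded real sequences is kept.\<close>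

locale bounded_limit =
  fixes U :: "nat filter"
  assumes proper: "U \<noteq> bot"
    and le_sequentially: "U \<le> sequentially"
    and bounded_convergent: "\<And>f :: nat \<Rightarrow> real. bounded (range f) \<Longrightarrow> \<exists>L. (f \<longlongrightarrow> L) U"

text \<open>The first index is the stage of the ultraproduct, the second numbers the members of the
  finite family at that stage. The family size is not stored here but passed to
  \<open>mean\<close>.\<close>

type_synonym 'a internal = "nat \<Rightarrow> nat \<Rightarrow> 'a \<Rightarrow> real"

definition scale :: "real \<Rightarrow> 'a internal \<Rightarrow> 'a internal" where
  "scale c F = (\<lambda>s w x. c * F s w x)"

text \<open>The bound holds at every point, not just almost everywhere, so products and averages can
  be estimated pointwise without exceptional sets.\<close>

definition bounded_by :: "'a measure \<Rightarrow> real \<Rightarrow> 'a internal \<Rightarrow> bool" where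
  "bounded_by M C F \<longleftrightarrow> (\<forall>s w. F s w \<in> borel_measurable M) \<and> (\<forall>s w x. \<bar>F s w x\<bar> \<le> C)"

definition bounded_internal :: "'a measure \<Rightarrow> 'a internal set" where
  "bounded_internal M = {F. \<exists>C. bounded_by M C F}"

text \<open>The length may vary with the stage. Constant \<open>N\<close> gives ordinary averages;
  an \<open>N\<close> tending to infinity along \<open>U\<close> gives averages of infinite length
  in the ultraproduct.\<close>

definition internal_average :: "(nat \<Rightarrow> nat) \<Rightarrow> (nat \<Rightarrow> 'a internal) \<Rightarrow> 'a internal" where
  "internal_average N G = (\<lambda>s w x. (\<Sum>n=1..N s. G n s w x) / N s)"

definition shift :: "('a \<Rightarrow> 'a) \<Rightarrow> 'a internal \<Rightarrow> 'a internal" where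
  "shift g F = (\<lambda>s w x. F s w (g x))"

lemma bounded_byD:
  assumes "bounded_by M C F"
  shows "F s w \<in> borel_measurable M" "\<bar>F s w x\<bar> \<le> C" "C \<ge> 0"
proof -
  show "F s w \<in> borel_measurable M" and le: "\<bar>F s w x\<bar> \<le> C" for s w x
    using assms by (auto simp: bounded_by_def)
  show "C \<ge> 0" using order_trans[OF abs_ge_zero le] .
qed

lemma bounded_by_mono: "bounded_by M C F \<Longrightarrow> C \<le> C' \<Longrightarrow> bounded_by M C' F"
  unfolding bounded_by_def using order_trans by blast

lemma bounded_internalE:
  assumes "F \<in> bounded_internal M"
  obtains C where "bounded_by M C F"
  using assms by (auto simp: bounded_internal_def)

lemma bounded_internalI: "bounded_by M C F \<Longrightarrow> F \<in> bounded_internal M"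
  by (auto simp: bounded_internal_def)

lemma bounded_by_mult:
  assumes "bounded_by M C F" "bounded_by M D G"
  shows "bounded_by M (C * D) (F * G)"
  unfolding bounded_by_def
proof (intro conjI allI)
  fix s w x
  have [measurable]: "F s w \<in> borel_measurable M" "G s w \<in> borel_measurable M"
    using assms by (auto simp: bounded_by_def)
  show "(F * G) s w \<in> borel_measurable M" by (simp add: times_fun_def)
  show "\<bar>(F * G) s w x\<bar> \<le> C * D"
    using assms unfolding bounded_by_def times_fun_def abs_mult
    by (intro mult_mono) (use assms[THEN bounded_byD(3)] in auto)
qed

lemma bounded_by_prod:
  assumes "\<And>i. i \<in> I \<Longrightarrow> bounded_by M C (F i)"
  shows "bounded_by M (C ^ card I) (\<lambda>s w x. \<Prod>i\<in>I. F i s w x)"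
  unfolding bounded_by_def
proof (intro conjI allI)
  fix s w x
  show "(\<lambda>x. \<Prod>i\<in>I. F i s w x) \<in> borel_measurable M"
    using assms by (intro borel_measurable_prod) (auto simp: bounded_by_def)
  have "(\<Prod>i\<in>I. \<bar>F i s w x\<bar>) \<le> (\<Prod>i\<in>I. C)"
    by (intro prod_mono) (use assms in \<open>auto simp: bounded_by_def\<close>)
  then show "\<bar>\<Prod>i\<in>I. F i s w x\<bar> \<le> C ^ card I" by (simp add: abs_prod)
qed

lemma bounded_by_average:
  assumes "\<And>n. bounded_by M C (G n)"
  shows "bounded_by M C (internal_average N G)"
  unfolding bounded_by_def internal_average_def
proof (intro conjI allI)
  fix s w x
  have [measurable]: "G n s w \<in> borel_measurable M" for n
    using assms by (auto simp: bounded_by_def)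
  show "(\<lambda>x. (\<Sum>n=1..N s. G n s w x) / N s) \<in> borel_measurable M" by simp
  show "\<bar>(\<Sum>n=1..N s. G n s w x) / N s\<bar> \<le> C"
    by (rule average_abs_le) (use assms bounded_byD(3)[OF assms] in \<open>auto simp: bounded_by_def\<close>)
qed

lemma bounded_by_shift:
  assumes "bounded_by M C F" "g \<in> measurable M M"
  shows "bounded_by M C (shift g F)"
  using assms by (auto simp: bounded_by_def shift_def intro: measurable_compose)

lemma bounded_by_add:
  assumes "bounded_by M C F" "bounded_by M D G"
  shows "bounded_by M (C + D) (F + G)"
  using assms unfolding bounded_by_def
  by (auto simp: plus_fun_def intro!: order_trans[OF abs_triangle_ineq] add_mono borel_measurable_add)

lemma bounded_by_diff:
  assumes "bounded_by M C F" "bounded_by M D G"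
  shows "bounded_by M (C + D) (F - G)"
  using assms unfolding bounded_by_def fun_diff_def
  by (blast intro: order_trans[OF abs_triangle_ineq4] add_mono borel_measurable_diff)

lemma bounded_by_scale:
  assumes "bounded_by M C F"
  shows "bounded_by M (\<bar>c\<bar> * C) (scale c F)"
  using assms unfolding bounded_by_def
  by (auto simp: scale_def abs_mult intro!: mult_left_mono borel_measurable_times)

lemma bounded_internal_closed:
  shows "F \<in> bounded_internal M \<Longrightarrow> G \<in> bounded_internal M \<Longrightarrow> F + G \<in> bounded_internal M"
    and "F \<in> bounded_internal M \<Longrightarrow> G \<in> bounded_internal M \<Longrightarrow> F - G \<in> bounded_internal M"
    and "F \<in> bounded_internal M \<Longrightarrow> G \<in> bounded_internal M \<Longrightarrow> F * G \<in> bounded_internal M"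
    and "F \<in> bounded_internal M \<Longrightarrow> scale c F \<in> bounded_internal M"
  by (auto simp: bounded_internal_def
      intro: bounded_by_add bounded_by_diff bounded_by_mult bounded_by_scale)

lemma bounded_internal_const: "(\<lambda>s w x. c) \<in> bounded_internal M"
  by (auto simp: bounded_internal_def bounded_by_def)

section \<open>Expectation in the ultraproduct and its quadratic seminorm\<close>

locale internal_prob_space = prob_space M + bounded_limit U
  for M :: "'a measure" and U :: "nat filter"
begin

abbreviation "BI \<equiv> bounded_internal M"

definition mean :: "(nat \<Rightarrow> nat) \<Rightarrow> 'a internal \<Rightarrow> nat \<Rightarrow> real" where
  "mean k F s = (\<Sum>w<k s. \<integral>x. F s w x \<partial>M) / k s"

definition tr :: "(nat \<Rightarrow> nat) \<Rightarrow> 'a internal \<Rightarrow> real" where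
  "tr k F = Lim U (mean k F)"

definition sqnorm :: "(nat \<Rightarrow> nat) \<Rightarrow> 'a internal \<Rightarrow> real" where
  "sqnorm k F = tr k (F * F)"

text \<open>The limit along \<open>U\<close> inside \<open>sqnorm\<close> is taken for fixed
  \<open>m\<close> and \<open>n\<close>, so \<open>n0\<close> is an ordinary natural number that
  does not vary with the stage.\<close>

definition mean_cauchy :: "(nat \<Rightarrow> nat) \<Rightarrow> (nat \<Rightarrow> 'a internal) \<Rightarrow> bool" where
  "mean_cauchy k F \<longleftrightarrow> (\<forall>e>0. \<exists>n0. \<forall>m\<ge>n0. \<forall>n\<ge>n0. sqnorm k (F m - F n) \<le> e)"

lemma BI_integrable:
  assumes "F \<in> BI"
  shows "integrable M (F s w)"
proof -
  from assms obtain C where "bounded_by M C F" by (rule bounded_internalE)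
  then show ?thesis
    by (intro integrable_const_bound[of _ C]) (auto simp: bounded_by_def)
qed

lemma mean_bounded:
  assumes "bounded_by M C F"
  shows "\<bar>mean k F s\<bar> \<le> C"
proof -
  have F: "integrable M (F s w)" for w
    using BI_integrable[OF bounded_internalI[OF assms]] .
  have C: "0 \<le> C" using bounded_byD(3)[OF assms] .
  have "\<bar>\<integral>x. F s w x \<partial>M\<bar> \<le> C" for w
  proof -
    have "\<bar>\<integral>x. F s w x \<partial>M\<bar> \<le> (\<integral>x. \<bar>F s w x\<bar> \<partial>M)" by simp
    also have "\<dots> \<le> (\<integral>x. C \<partial>M)"
      using assms F by (intro integral_mono) (auto simp: bounded_by_def)
    finally show ?thesis by (simp add: prob_space)
  qed
  then have "\<bar>\<Sum>w<k s. \<integral>x. F s w x \<partial>M\<bar> \<le> (\<Sum>w<k s. C)"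
    by (intro order_trans[OF sum_abs] sum_mono)
  then show ?thesis using C
    by (cases "k s = 0") (simp_all add: mean_def field_simps)
qed

lemma mean_linear:
  assumes "F \<in> BI" "G \<in> BI"
  shows "mean k (F + G) s = mean k F s + mean k G s"
    "mean k (F - G) s = mean k F s - mean k G s"
  using BI_integrable[OF assms(1)] BI_integrable[OF assms(2)]
  by (simp_all add: mean_def plus_fun_def fun_diff_def sum.distrib sum_subtractf
      add_divide_distrib diff_divide_distrib)

lemma mean_scale: "mean k (scale c F) s = c * mean k F s"
  by (simp add: mean_def scale_def flip: sum_distrib_left)

lemma mean_mono:
  assumes "F \<in> BI" "G \<in> BI" "\<And>w x. F s w x \<le> G s w x"
  shows "mean k F s \<le> mean k G s"
  unfolding mean_def
  by (intro divide_right_mono sum_mono integral_mono BI_integrable assms) simp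

lemma mean_average:
  assumes "\<And>n. bounded_by M C (G n)"
  shows "mean k (internal_average N G) s = (\<Sum>n=1..N s. mean k (G n) s) / N s"
proof -
  have "integrable M (G n s w)" for n w
    by (rule BI_integrable[OF bounded_internalI[OF assms]])
  then have "(\<integral>x. internal_average N G s w x \<partial>M) = (\<Sum>n=1..N s. \<integral>x. G n s w x \<partial>M) / N s" for w
    unfolding internal_average_def by (subst integral_divide_zero) (simp add: integral_sum)
  then have "mean k (internal_average N G) s
      = (\<Sum>w<k s. \<Sum>n=1..N s. \<integral>x. G n s w x \<partial>M) / N s / k s"
    by (simp add: mean_def sum_divide_distrib)
  also have "\<dots> = (\<Sum>n=1..N s. \<Sum>w<k s. \<integral>x. G n s w x \<partial>M) / N s / k s"
    by (subst sum.swap) simp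
  also have "\<dots> = (\<Sum>n=1..N s. mean k (G n) s) / N s"
    by (simp add: mean_def sum_divide_distrib mult.commute)
  finally show ?thesis .
qed

lemma mean_shift:
  assumes "F \<in> BI" "g \<in> measurable M M" "distr M M g = M"
  shows "mean k (shift g F) s = mean k F s"
proof -
  obtain C where "bounded_by M C F" using assms(1) by (rule bounded_internalE)
  then have "F s w \<in> borel_measurable M" for w by (simp add: bounded_by_def)
  then have "(\<integral>x. F s w (g x) \<partial>M) = (\<integral>x. F s w x \<partial>M)" for w
    using integral_distr[OF assms(2), of "F s w"] assms(3) by simp
  then show ?thesis by (simp add: mean_def shift_def)
qed

lemma tr_tendsto:
  assumes "F \<in> BI"
  shows "(mean k F \<longlongrightarrow> tr k F) U"
proof -
  obtain C where "bounded_by M C F" using assms by (rule bounded_internalE)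
  then have "bounded (range (mean k F))"
    by (auto simp: bounded_iff intro!: exI[of _ C] mean_bounded)
  then obtain L where L: "(mean k F \<longlongrightarrow> L) U" using bounded_convergent by blast
  then show ?thesis
    using proper by (simp add: tr_def tendsto_Lim)
qed

lemma tr_eqI: "F \<in> BI \<Longrightarrow> (mean k F \<longlongrightarrow> L) U \<Longrightarrow> tr k F = L"
  by (rule tendsto_unique[OF proper tr_tendsto])

lemma tr_linear:
  assumes "F \<in> BI" "G \<in> BI"
  shows "tr k (F + G) = tr k F + tr k G"
    "tr k (F - G) = tr k F - tr k G"
  by (intro tr_eqI bounded_internal_closed assms; subst mean_linear[OF assms, abs_def];
      intro tendsto_intros tr_tendsto assms)+

lemma tr_scale: "F \<in> BI \<Longrightarrow> tr k (scale c F) = c * tr k F"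
  by (intro tr_eqI bounded_internal_closed) (auto simp: mean_scale[abs_def] intro!: tendsto_intros tr_tendsto)

text \<open>The two sides may have different family sizes, which allows comparison with glued
  families, and an error vanishing along \<open>U\<close> is tolerated, which absorbs boundary
  terms.\<close>

lemma tr_le:
  assumes "F \<in> BI" "G \<in> BI" "(e \<longlongrightarrow> 0) U" "\<And>s. mean k F s \<le> mean k' G s + e s"
  shows "tr k F \<le> tr k' G"
proof (rule tendsto_le[OF proper _ tr_tendsto[OF assms(1)]])
  show "((\<lambda>s. mean k' G s + e s) \<longlongrightarrow> tr k' G) U"
    using tendsto_add[OF tr_tendsto[OF assms(2)] assms(3)] by simp
qed (use assms(4) in simp)

lemma tr_mono:
  assumes "F \<in> BI" "G \<in> BI" "\<And>s w x. F s w x \<le> G s w x"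
  shows "tr k F \<le> tr k G"
  by (rule tr_le[OF assms(1,2), of "\<lambda>_. 0"]) (use mean_mono[OF assms] in auto)

lemma tr_cong:
  assumes "\<And>s. mean k F s = mean k' G s"
  shows "tr k F = tr k' G"
proof -
  have "mean k F = mean k' G" using assms by blast
  then show ?thesis by (simp add: tr_def)
qed

lemma sqnorm_nonneg:
  assumes "F \<in> BI"
  shows "0 \<le> sqnorm k F"
proof -
  have "tr k (\<lambda>s w x. 0) \<le> tr k (F * F)"
    by (rule tr_mono) (use bounded_internal_closed assms in \<open>auto simp: bounded_internal_const\<close>)
  moreover have "tr k (\<lambda>s w x. 0) = 0"
    by (rule tr_eqI) (simp_all add: bounded_internal_const mean_def[abs_def])
  ultimately show ?thesis by (simp add: sqnorm_def)
qed

lemma sqnorm_diff: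
  assumes "F \<in> BI" "G \<in> BI"
  shows "sqnorm k (F - G) = sqnorm k F - 2 * tr k (F * G) + sqnorm k G"
proof -
  have "(F - G) * (F - G) = F * F - scale 2 (F * G) + G * G"
    by (simp add: fun_eq_iff scale_def algebra_simps)
  then show ?thesis
    using assms by (simp add: sqnorm_def tr_linear tr_scale bounded_internal_closed)
qed

lemma sqnorm_scale:
  assumes "F \<in> BI"
  shows "sqnorm k (scale c F) = c\<^sup>2 * sqnorm k F"
proof -
  have "scale c F * scale c F = scale (c\<^sup>2) (F * F)"
    by (simp add: fun_eq_iff scale_def power2_eq_square algebra_simps)
  then show ?thesis
    using assms by (simp add: sqnorm_def tr_linear tr_scale bounded_internal_closed)
qed

lemma sqnorm_add:
  assumes "F \<in> BI" "G \<in> BI"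
  shows "sqnorm k (F + G) = sqnorm k F + 2 * tr k (F * G) + sqnorm k G"
proof -
  have "(F + G) * (F + G) = F * F + scale 2 (F * G) + G * G"
    by (simp add: fun_eq_iff scale_def algebra_simps)
  then show ?thesis
    using assms by (simp add: sqnorm_def tr_linear tr_scale bounded_internal_closed)
qed

text \<open>Expands the nonnegative seminorm of \<open>F - G\<close>. For \<open>tr\<close> this
  takes the place of the Cauchy-Schwarz inequality.\<close>

lemma tr_mult_le:
  assumes "F \<in> BI" "G \<in> BI"
  shows "2 * tr k (F * G) \<le> sqnorm k F + sqnorm k G"
  using sqnorm_diff[OF assms, of k] sqnorm_nonneg[OF bounded_internal_closed(2)[OF assms], of k]
  by linarith

lemma sqnorm_parallelogram:
  assumes "F \<in> BI" "G \<in> BI"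
  shows "sqnorm k (F - G) = 2 * sqnorm k F + 2 * sqnorm k G - sqnorm k (F + G)"
  using sqnorm_add[OF assms, of k] sqnorm_diff[OF assms, of k] by linarith

lemma sqnorm_add_le:
  assumes "F \<in> BI" "G \<in> BI"
  shows "sqnorm k (F + G) \<le> 2 * sqnorm k F + 2 * sqnorm k G"
  using sqnorm_add[OF assms, of k] tr_mult_le[OF assms, of k] by linarith

lemma sqnorm_diff_le:
  assumes "F \<in> BI" "G \<in> BI"
  shows "sqnorm k (F - G) \<le> 2 * sqnorm k F + 2 * sqnorm k G"
  using sqnorm_add[OF assms, of k] sqnorm_diff[OF assms, of k]
    sqnorm_nonneg[OF bounded_internal_closed(1)[OF assms], of k] by linarith

lemma mean_cauchy_add:
  assumes "\<And>n. F n \<in> BI" "\<And>n. G n \<in> BI" "mean_cauchy k F" "mean_cauchy k G"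
  shows "mean_cauchy k (\<lambda>n. F n + G n)"
  unfolding mean_cauchy_def
proof (intro allI impI)
  fix e :: real assume "e > 0"
  then have e4: "e / 4 > 0" by simp
  from assms(3)[unfolded mean_cauchy_def, rule_format, OF e4] obtain n1 where
    n1: "\<And>m n. m \<ge> n1 \<Longrightarrow> n \<ge> n1 \<Longrightarrow> sqnorm k (F m - F n) \<le> e / 4" by auto
  from assms(4)[unfolded mean_cauchy_def, rule_format, OF e4] obtain n2 where
    n2: "\<And>m n. m \<ge> n2 \<Longrightarrow> n \<ge> n2 \<Longrightarrow> sqnorm k (G m - G n) \<le> e / 4"
    by auto
  show "\<exists>n0. \<forall>m\<ge>n0. \<forall>n\<ge>n0. sqnorm k (F m + G m - (F n + G n)) \<le> e"
  proof (intro exI[of _ "max n1 n2"] allI impI)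
    fix m n assume mn: "max n1 n2 \<le> m" "max n1 n2 \<le> n"
    have "sqnorm k ((F m - F n) + (G m - G n)) \<le> 2 * sqnorm k (F m - F n) + 2 * sqnorm k (G m - G n)"
      by (intro sqnorm_add_le bounded_internal_closed assms)
    also have "\<dots> \<le> e" using n1[of m n] n2[of m n] mn by simp
    finally show "sqnorm k (F m + G m - (F n + G n)) \<le> e"
      by (simp add: algebra_simps)
  qed
qed

lemma mean_cauchy_scale:
  assumes "\<And>n. F n \<in> BI" "mean_cauchy k F"
  shows "mean_cauchy k (\<lambda>n. scale c (F n))"
  unfolding mean_cauchy_def
proof (intro allI impI)
  fix e :: real assume e: "e > 0"
  \<comment> \<open>Adding 1 avoids a division by zero when \<open>c = 0\<close>.\<close>
  have c: "c\<^sup>2 + 1 > 0" by (simp add: add_nonneg_pos)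
  obtain n0 where
    n0: "\<And>m n. m \<ge> n0 \<Longrightarrow> n \<ge> n0 \<Longrightarrow> sqnorm k (F m - F n) \<le> e / (c\<^sup>2 + 1)"
    using assms(2)[unfolded mean_cauchy_def, rule_format, of "e / (c\<^sup>2 + 1)"] e c by auto
  show "\<exists>n0. \<forall>m\<ge>n0. \<forall>n\<ge>n0. sqnorm k (scale c (F m) - scale c (F n)) \<le> e"
  proof (intro exI[of _ n0] allI impI)
    fix m n assume mn: "n0 \<le> m" "n0 \<le> n"
    have "scale c (F m) - scale c (F n) = scale c (F m - F n)"
      by (simp add: fun_eq_iff scale_def algebra_simps)
    then have "sqnorm k (scale c (F m) - scale c (F n)) = c\<^sup>2 * sqnorm k (F m - F n)"
      by (simp add: sqnorm_scale bounded_internal_closed assms)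
    also have "\<dots> \<le> (c\<^sup>2 + 1) * (e / (c\<^sup>2 + 1))"
      using n0[OF mn] by (intro mult_mono) (auto intro!: sqnorm_nonneg bounded_internal_closed assms)
    finally show "sqnorm k (scale c (F m) - scale c (F n)) \<le> e" using c by simp
  qed
qed

end

subsection \<open>Averages along commuting transformations\<close>

lemma funpow_commute_apply:
  assumes "\<And>x. f (g x) = g (f x)"
  shows "(f ^^ m) ((g ^^ n) x) = (g ^^ n) ((f ^^ m) x)"
proof -
  have 1: "f ((g ^^ n) x) = (g ^^ n) (f x)" for x
    by (induction n) (simp_all add: assms)
  show ?thesis by (induction m) (simp_all add: 1)
qed

lemma funpow_left_inverse:
  fixes r s :: "'a \<Rightarrow> 'a"
  assumes "\<And>x. r (s x) = x"
  shows "(r ^^ n) ((s ^^ n) x) = x"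
proof (induction n)
  case (Suc n)
  then show ?case by (simp add: funpow_swap1[of r] assms)
qed simp

lemma distr_funpow:
  assumes "g \<in> measurable M M" "distr M M g = M"
  shows "distr M M (g ^^ n) = M"
proof (induction n)
  case 0 then show ?case by (simp add: distr_id[unfolded id_def] id_def)
next
  case (Suc n)
  have "distr M M (g ^^ Suc n) = distr (distr M M (g ^^ n)) M g"
    using assms(1) by (simp add: distr_distr measurable_compose_n)
  with Suc assms(2) show ?case by (simp del: funpow.simps)
qed

text \<open>The index \<open>w < k s * N s\<close> encodes the pair of \<open>m = Suc (w div k s)\<close> in \<open>{1..N s}\<close> and
  \<open>w mod k s < k s\<close>.\<close>

definition glue :: "(nat \<Rightarrow> nat) \<Rightarrow> (nat \<Rightarrow> 'a internal) \<Rightarrow> 'a internal" where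
  "glue k G = (\<lambda>s w. G (Suc (w div k s)) s (w mod k s))"

lemma bounded_by_glue:
  "(\<And>m. bounded_by M C (G m)) \<Longrightarrow> bounded_by M C (glue k G)"
  by (auto simp: bounded_by_def glue_def)

text \<open>\<open>R i\<close> is the inverse of \<open>T i\<close>. The identities are required at
  every point and for every index, so that orbits can be computed without side conditions.\<close>

locale commuting_system = internal_prob_space M U
  for M :: "'a measure" and U :: "nat filter" +
  fixes T R :: "nat \<Rightarrow> 'a \<Rightarrow> 'a"
  assumes T_measurable: "T i \<in> measurable M M"
    and R_measurable: "R i \<in> measurable M M"
    and distr_T: "distr M M (T i) = M"
    and R_T: "R i (T i x) = x"
    and T_R: "T i (R i x) = x"
    and T_T: "T i (T j x) = T j (T i x)"
begin

text \<open>Averaging over the glued indices is averaging over the family and over \<open>m\<close>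
  in \<open>{1..N s}\<close>. Thus an average over \<open>m\<close> can be traded for a larger
  family.\<close>

lemma mean_glue:
  assumes "\<And>n. bounded_by M C (G n)"
  shows "mean (\<lambda>s. k s * N s) (glue k G) s = mean k (internal_average N G) s"
proof (cases "k s = 0")
  case False
  have "(\<Sum>w<k s * N s. \<integral>x. glue k G s w x \<partial>M)
      = (\<Sum>m<N s. \<Sum>w=m * k s..<m * k s + k s. \<integral>x. glue k G s w x \<partial>M)"
    by (subst sum.nat_group) (simp add: mult.commute)
  also have "\<dots> = (\<Sum>m<N s. \<Sum>w<k s. \<integral>x. G (Suc m) s w x \<partial>M)"
  proof (rule sum.cong[OF refl])
    fix m
    have "(\<Sum>w=m * k s..<m * k s + k s. \<integral>x. glue k G s w x \<partial>M)
        = (\<Sum>w=0..<k s. \<integral>x. glue k G s (w + m * k s) x \<partial>M)"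
      using sum.shift_bounds_nat_ivl[of _ 0 "m * k s" "k s"] by (simp add: add.commute)
    also have "\<dots> = (\<Sum>w<k s. \<integral>x. G (Suc m) s w x \<partial>M)"
      by (simp add: glue_def atLeast0LessThan)
    finally show "(\<Sum>w=m * k s..<m * k s + k s. \<integral>x. glue k G s w x \<partial>M)
        = (\<Sum>w<k s. \<integral>x. G (Suc m) s w x \<partial>M)" .
  qed
  also have "\<dots> = (\<Sum>m=1..N s. \<Sum>w<k s. \<integral>x. G m s w x \<partial>M)"
    by (simp add: sum.atLeast1_atMost_eq)
  finally show ?thesis
    unfolding mean_average[OF assms]
    using False by (simp add: mean_def mult.commute flip: sum_divide_distrib)
qed (simp add: mean_def)

lemma T_power: "T i ^^ n \<in> measurable M M" "distr M M (T i ^^ n) = M"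
  using T_measurable distr_T by (auto intro: measurable_compose_n distr_funpow)

lemma R_power_measurable: "R i ^^ n \<in> measurable M M"
  using R_measurable by (rule measurable_compose_n)

lemma T_R_power_commute: "(R j ^^ m) ((T i ^^ n) x) = (T i ^^ n) ((R j ^^ m) x)"
proof (rule funpow_commute_apply)
  show "R j (T i x) = T i (R j x)" for x
    \<comment> \<open>Write \<open>x\<close> as \<open>T j (R j x)\<close>, exchange
      \<open>T i\<close> and \<open>T j\<close>, and cancel \<open>R j\<close> against
      \<open>T j\<close>.\<close>
    by (metis R_T T_R T_T)
qed

definition prod_shift :: "nat \<Rightarrow> (nat \<Rightarrow> 'a internal) \<Rightarrow> nat \<Rightarrow> 'a internal" where
  "prod_shift j f n = (\<lambda>s w x. \<Prod>i=1..j. f i s w ((T i ^^ n) x))"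

definition erg_average :: "nat \<Rightarrow> (nat \<Rightarrow> 'a internal) \<Rightarrow> (nat \<Rightarrow> nat) \<Rightarrow> 'a internal" where
  "erg_average j f N = internal_average N (prod_shift j f)"

definition last_average ::
    "nat \<Rightarrow> (nat \<Rightarrow> 'a internal) \<Rightarrow> (nat \<Rightarrow> nat) \<Rightarrow> 'a internal \<Rightarrow> 'a internal" where
  "last_average j f N g = internal_average N (\<lambda>n. prod_shift j f n * shift (T (Suc j) ^^ n) g)"

text \<open>The adjoint of \<open>last_average j f N\<close> with respect to \<open>tr\<close>: the
  power of \<open>T (Suc j)\<close> on the last function is moved to the other factors as a power of
  the inverse.\<close>

definition dual_average ::
    "nat \<Rightarrow> (nat \<Rightarrow> 'a internal) \<Rightarrow> (nat \<Rightarrow> nat) \<Rightarrow> 'a internal \<Rightarrow> 'a internal" where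
  "dual_average j f N b = internal_average N (\<lambda>n. shift (R (Suc j) ^^ n) (b * prod_shift j f n))"

text \<open>The statement proved by induction on \<open>j\<close>. It ranges over all family sizes
  because the induction step passes from \<open>k s\<close> to \<open>k s * N s\<close>.\<close>

definition averages_converge :: "nat \<Rightarrow> bool" where
  "averages_converge j \<longleftrightarrow> (\<forall>k f. (\<forall>s. 0 < k s) \<longrightarrow> (\<forall>i. f i \<in> BI) \<longrightarrow>
     mean_cauchy k (\<lambda>n. erg_average j f (\<lambda>_. n)))"

lemma erg_average_Suc: "erg_average (Suc j) f N = last_average j f N (f (Suc j))"
  by (simp add: erg_average_def last_average_def prod_shift_def[abs_def] shift_def times_fun_def)

lemma last_average_linear:
  "last_average j f N (g + h) = last_average j f N g + last_average j f N h"
  "last_average j f N (g - h) = last_average j f N g - last_average j f N h"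
  "last_average j f N (scale c g) = scale c (last_average j f N g)"
  by (simp_all add: fun_eq_iff last_average_def internal_average_def shift_def scale_def
      algebra_simps sum.distrib sum_subtractf add_divide_distrib diff_divide_distrib
      sum_distrib_left)

context
  fixes j :: nat and f :: "nat \<Rightarrow> 'a internal" and C :: real
  assumes f_bounded: "\<And>i. i \<in> {1..j} \<Longrightarrow> bounded_by M C (f i)" and C_nonneg: "0 \<le> C"
begin

lemma prod_shift_bounded: "bounded_by M (C ^ j) (prod_shift j f n)"
  using bounded_by_prod[of "{1..j}" M C "\<lambda>i. shift (T i ^^ n) (f i)"]
  by (simp add: prod_shift_def shift_def bounded_by_shift[unfolded shift_def] f_bounded T_power)

lemma erg_average_bounded: "bounded_by M (C ^ j) (erg_average j f N)"
  unfolding erg_average_def by (intro bounded_by_average prod_shift_bounded)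

lemma last_average_bounded:
  assumes "bounded_by M D g"
  shows "bounded_by M (C ^ j * D) (last_average j f N g)"
  unfolding last_average_def
  by (intro bounded_by_average bounded_by_mult prod_shift_bounded bounded_by_shift assms T_power)

lemma last_average_BI: "g \<in> BI \<Longrightarrow> last_average j f N g \<in> BI"
  using last_average_bounded by (auto simp: bounded_internal_def)

lemma dual_average_bounded:
  assumes "bounded_by M D b"
  shows "bounded_by M (D * C ^ j) (dual_average j f N b)"
  unfolding dual_average_def
  by (intro bounded_by_average bounded_by_mult prod_shift_bounded bounded_by_shift assms
      R_power_measurable)

lemma dual_average_BI: "b \<in> BI \<Longrightarrow> dual_average j f N b \<in> BI"
  using dual_average_bounded by (auto simp: bounded_internal_def)

text \<open>Convexity of the square, the bound \<open>C ^ j\<close> on the product, and invariance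
  of the measure. The constant is the same for all lengths \<open>N\<close>, even those varying with
  the stage.\<close>

lemma sqnorm_last_average_le:
  assumes g: "g \<in> BI"
  shows "sqnorm k (last_average j f N g) \<le> (C ^ j)\<^sup>2 * sqnorm k g"
proof -
  let ?c = "C ^ j"
  let ?g = "\<lambda>n. scale (?c\<^sup>2) (shift (T (Suc j) ^^ n) (g * g))"
  obtain D where D: "bounded_by M D g" using g by (rule bounded_internalE)
  have bg: "bounded_by M (?c\<^sup>2 * (D * D)) (?g n)" for n
    using bounded_by_scale[OF bounded_by_shift[OF bounded_by_mult[OF D D] T_power(1)], of "?c\<^sup>2"]
    by simp
  have "tr k (last_average j f N g * last_average j f N g) \<le> tr k (scale (?c\<^sup>2) (g * g))"
  proof (rule tr_le[where e = "\<lambda>_. 0"])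
    fix s
    have "mean k (last_average j f N g * last_average j f N g) s \<le> mean k (internal_average N ?g) s"
    proof (rule mean_mono)
      show "internal_average N ?g \<in> BI"
        using bounded_by_average[OF bg] by (rule bounded_internalI)
      fix s w x
      let ?a = "\<lambda>n. prod_shift j f n s w x * g s w ((T (Suc j) ^^ n) x)"
      have "(last_average j f N g * last_average j f N g) s w x = ((\<Sum>n=1..N s. ?a n) / N s)\<^sup>2"
        by (simp add: last_average_def internal_average_def shift_def power2_eq_square)
      also have "\<dots> \<le> (\<Sum>n=1..N s. (?a n)\<^sup>2) / N s"
        by (rule average_square_le)
      also have "\<dots> \<le> internal_average N ?g s w x"
        unfolding internal_average_def
      proof (intro divide_right_mono sum_mono)
        fix n
        have "(prod_shift j f n s w x)\<^sup>2 \<le> ?c\<^sup>2"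
          using bounded_byD(2)[OF prod_shift_bounded, of n s w x]
          by (rule power2_le_iff_abs_le[THEN iffD2, rotated]) (simp add: C_nonneg)
        then show "(?a n)\<^sup>2 \<le> ?g n s w x"
          by (simp add: power_mult_distrib scale_def shift_def mult_right_mono
                flip: power2_eq_square[of "g s w ((T (Suc j) ^^ n) x)"])
      qed simp
      finally show "(last_average j f N g * last_average j f N g) s w x \<le> internal_average N ?g s w x" .
    qed (intro bounded_internal_closed last_average_BI g)+
    also have "\<dots> = (\<Sum>n=1..N s. ?c\<^sup>2 * mean k (g * g) s) / N s"
      by (subst mean_average[OF bg])
        (simp add: mean_scale mean_shift bounded_internal_closed g T_power)
    \<comment> \<open>For \<open>N s = 0\<close> the left side is 0 by the convention on division,
      so nonnegativity of the mean is used.\<close>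
    also have "\<dots> \<le> ?c\<^sup>2 * mean k (g * g) s"
    proof -
      have "0 \<le> mean k (g * g) s"
        using mean_mono[of "\<lambda>s w x. 0" "g * g" s k] g
        by (simp add: bounded_internal_const bounded_internal_closed mean_def)
      then show ?thesis by (cases "N s = 0") simp_all
    qed
    finally show "mean k (last_average j f N g * last_average j f N g) s
        \<le> mean k (scale (?c\<^sup>2) (g * g)) s + 0" by (simp add: mean_scale)
  qed (auto intro!: bounded_internal_closed last_average_BI g)
  then show ?thesis
    by (simp add: sqnorm_def tr_scale bounded_internal_closed g)
qed

text \<open>Holds term by term at each stage: composing the \<open>n\<close>-th term with the
  \<open>n\<close>-th power of \<open>T (Suc j)\<close> cancels the power of
  \<open>R (Suc j)\<close> and preserves the mean.\<close>

lemma dual_average_adjoint: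
  assumes "b \<in> BI" "h \<in> BI"
  shows "tr k (dual_average j f N b * h) = tr k (b * last_average j f N h)"
proof (rule tr_cong)
  fix s
  obtain D E where D: "bounded_by M D b" and E: "bounded_by M E h"
    using assms by (auto elim!: bounded_internalE)
  let ?G = "\<lambda>n. shift (R (Suc j) ^^ n) (b * prod_shift j f n) * h"
  let ?H = "\<lambda>n. b * (prod_shift j f n * shift (T (Suc j) ^^ n) h)"
  have G: "bounded_by M (D * C ^ j * E) (?G n)" and H: "bounded_by M (D * (C ^ j * E)) (?H n)" for n
    by (intro bounded_by_mult bounded_by_shift R_power_measurable T_power prod_shift_bounded D E)+
  have eq: "mean k (?H n) s = mean k (?G n) s" for n
  proof -
    have "(R (Suc j) ^^ n) ((T (Suc j) ^^ n) x) = x" for x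
      by (rule funpow_left_inverse) (rule R_T)
    then have "?H n = shift (T (Suc j) ^^ n) (?G n)"
      by (simp add: fun_eq_iff shift_def)
    then show ?thesis
      by (simp add: mean_shift bounded_internalI[OF G] T_power)
  qed
  have "dual_average j f N b * h = internal_average N ?G"
    by (simp add: fun_eq_iff dual_average_def internal_average_def sum_distrib_right)
  moreover have "b * last_average j f N h = internal_average N ?H"
    by (simp add: fun_eq_iff last_average_def internal_average_def sum_distrib_left)
  ultimately show "mean k (dual_average j f N b * h) s = mean k (b * last_average j f N h) s"
    by (simp add: mean_average[OF G] mean_average[OF H] eq)
qed

end

end

section \<open>Averages of a dual function involve one transformation less\<close>

context commuting_system
begin

text \<open>Shifting \<^term>\<open>dual_average j f N b\<close> by the \<open>l\<close>-th power of \<^term>\<open>T (Suc j)\<close> amounts, up to boundary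
  terms, to replacing \<open>R\<^sup>m\<close> by \<open>R\<^sup>m\<^sup>-\<^sup>l\<close>.  Reindexing by \<open>m - l\<close> moves all dependence on \<open>l\<close> into the
  \<open>l\<close>-th powers of the first \<open>j\<close> transformations, and the factors combine as follows.\<close>

definition reduction :: "nat \<Rightarrow> (nat \<Rightarrow> 'a internal) \<Rightarrow> nat \<Rightarrow> nat \<Rightarrow> 'a internal" where
  "reduction j f m i = f i * shift ((T i ^^ m) \<circ> (R (Suc j) ^^ m)) (f i)"

text \<open>The two averages are in exchanged order: the inner one, over \<open>n\<close> shifts,
  involves only \<open>j\<close> transformations, and the outer one, over \<open>m\<close>, carries
  the weight from \<open>b\<close>.\<close>

definition reduced_average ::
    "nat \<Rightarrow> (nat \<Rightarrow> 'a internal) \<Rightarrow> (nat \<Rightarrow> nat) \<Rightarrow> 'a internal \<Rightarrow> nat \<Rightarrow> 'a internal" where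
  "reduced_average j f N b n = internal_average N
     (\<lambda>m. shift (R (Suc j) ^^ m) b * erg_average j (reduction j f m) (\<lambda>_. n))"

text \<open>Averages act on each member of a family separately. Hence convergence for the single
  glued family treats all parameters \<open>m\<close> at once.\<close>

lemma erg_average_glue:
  "erg_average j (\<lambda>i. glue k (\<lambda>m. h m i)) N = glue k (\<lambda>m. erg_average j (h m) N)"
  by (simp add: erg_average_def internal_average_def prod_shift_def glue_def)

context
  fixes j :: nat and f :: "nat \<Rightarrow> 'a internal" and C :: real
  assumes f_bounded: "\<And>i. i \<in> {1..j} \<Longrightarrow> bounded_by M C (f i)" and C_nonneg: "0 \<le> C"
begin

lemma reduction_bounded:
  assumes "i \<in> {1..j}"
  shows "bounded_by M (C * C) (reduction j f m i)"
  unfolding reduction_def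
  by (intro bounded_by_mult bounded_by_shift f_bounded assms measurable_comp[OF R_power_measurable T_power(1)])

lemma erg_average_reduction_bounded:
  "bounded_by M ((C * C) ^ j) (erg_average j (reduction j f m) N)"
  by (rule erg_average_bounded) (use reduction_bounded C_nonneg in auto)

lemma reduced_average_bounded:
  assumes "bounded_by M D b"
  shows "bounded_by M (D * (C * C) ^ j) (reduced_average j f N b n)"
  unfolding reduced_average_def
  by (intro bounded_by_average bounded_by_mult bounded_by_shift assms R_power_measurable
      erg_average_reduction_bounded)

text \<open>For each \<open>l \<le> n\<close>, the \<open>m\<close>-average from
  \<open>dual_average\<close>, evaluated after \<open>l\<close> shifts, is moved by \<open>l\<close>
  places using \<open>sum_shift_diff_le\<close>; what results is the summand of
  \<open>reduced_average\<close>.\<close>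

lemma last_average_dual_close:
  assumes "bounded_by M D b"
  shows "\<bar>last_average j f (\<lambda>_. n) (dual_average j f N b) s w x - reduced_average j f N b n s w x\<bar>
    \<le> C ^ j * (2 * n * (D * C ^ j) / N s)"
proof -
  let ?S = "T (Suc j)" and ?R = "R (Suc j)"
  define P where "P l y = prod_shift j f l s w y" for l y
  define Q where "Q l m = b s w ((?R ^^ m) x) * P (m + l) ((?R ^^ m) x)" for l m
  define a where "a l m = b s w ((?R ^^ m) ((?S ^^ l) x)) * P m ((?R ^^ m) ((?S ^^ l) x))" for l m
  have Cj: "0 \<le> C ^ j" using C_nonneg by simp
  have P_le: "\<bar>P l y\<bar> \<le> C ^ j" for l y
    unfolding P_def by (rule bounded_byD(2)[OF prod_shift_bounded]) (use f_bounded C_nonneg in auto)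
  have a_le: "\<bar>a l m\<bar> \<le> D * C ^ j" for l m
    unfolding a_def abs_mult
    by (intro mult_mono P_le bounded_byD[OF assms]) (use bounded_byD(3)[OF assms] in auto)
  \<comment> \<open>In the power \<open>m + l\<close> of the inverse, \<open>l\<close> factors
    cancel the \<open>l\<close> shifts, leaving the \<open>m\<close>-th power.\<close>
  have a_shift: "a l (m + l) = Q l m" for l m
    using funpow_left_inverse[of ?R ?S l x] by (simp add: a_def Q_def R_T funpow_add)
  have close: "\<bar>(\<Sum>m=1..N s. a l m) / N s - (\<Sum>m=1..N s. Q l m) / N s\<bar> \<le> 2 * l * (D * C ^ j) / N s" for l
    using sum_shift_diff_le[of "a l" "D * C ^ j" "N s" l] a_le
    by (simp add: a_shift divide_right_mono flip: diff_divide_distrib)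
  have red: "prod_shift j (reduction j f m) l s w x = P l x * P (m + l) ((?R ^^ m) x)" for l m
  proof -
    have "(T i ^^ m) ((R (Suc j) ^^ m) ((T i ^^ l) x)) = (T i ^^ (m + l)) ((R (Suc j) ^^ m) x)" for i
      by (simp add: T_R_power_commute funpow_add)
    then show ?thesis
      by (simp add: prod_shift_def reduction_def P_def shift_def prod.distrib)
  qed
  have "last_average j f (\<lambda>_. n) (dual_average j f N b) s w x
      = (\<Sum>l=1..n. P l x * ((\<Sum>m=1..N s. a l m) / N s)) / n"
    by (simp add: last_average_def dual_average_def internal_average_def shift_def P_def a_def)
  moreover have "reduced_average j f N b n s w x
      = (\<Sum>l=1..n. P l x * ((\<Sum>m=1..N s. Q l m) / N s)) / n"
  proof -
    have "reduced_average j f N b n s w x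
       = (\<Sum>m=1..N s. \<Sum>l=1..n. P l x * Q l m / (n * N s))"
      by (simp add: reduced_average_def erg_average_def internal_average_def shift_def red Q_def
          sum_divide_distrib sum_distrib_left mult_ac)
    also have "\<dots> = (\<Sum>l=1..n. \<Sum>m=1..N s. P l x * Q l m / (n * N s))"
      by (rule sum.swap)
    finally show ?thesis
      by (simp add: sum_divide_distrib sum_distrib_left mult_ac)
  qed
  ultimately have "last_average j f (\<lambda>_. n) (dual_average j f N b) s w x - reduced_average j f N b n s w x
      = (\<Sum>l=1..n. P l x * ((\<Sum>m=1..N s. a l m) / N s - (\<Sum>m=1..N s. Q l m) / N s)) / n"
    by (simp only: right_diff_distrib sum_subtractf diff_divide_distrib)
  also have "\<bar>\<dots>\<bar> \<le> C ^ j * (2 * n * (D * C ^ j) / N s)"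
  proof (rule average_abs_le)
    show "0 \<le> C ^ j * (2 * n * (D * C ^ j) / N s)"
      using Cj bounded_byD(3)[OF assms] by simp
    fix l assume l: "l \<in> {1..n}"
    have "2 * l * (D * C ^ j) / N s \<le> 2 * n * (D * C ^ j) / N s"
      using l Cj bounded_byD(3)[OF assms] by (intro divide_right_mono mult_right_mono) auto
    then show "\<bar>P l x * ((\<Sum>m=1..N s. a l m) / N s - (\<Sum>m=1..N s. Q l m) / N s)\<bar>
        \<le> C ^ j * (2 * n * (D * C ^ j) / N s)"
      unfolding abs_mult using order_trans[OF close[of l]] P_le Cj by (intro mult_mono) auto
  qed
  finally show ?thesis by simp
qed

text \<open>Convexity of the square moves the average over \<open>m\<close> outside, where the
  weight is at most \<open>D\<^sup>2\<close> and \<open>mean_glue\<close> absorbs the average into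
  the family.\<close>

lemma sqnorm_reduced_average_diff_le:
  assumes "bounded_by M D b"
  shows "sqnorm k (reduced_average j f N b m - reduced_average j f N b n)
    \<le> D\<^sup>2 * sqnorm (\<lambda>s. k s * N s)
        (erg_average j (\<lambda>i. glue k (\<lambda>m. reduction j f m i)) (\<lambda>_. m)
       - erg_average j (\<lambda>i. glue k (\<lambda>m. reduction j f m i)) (\<lambda>_. n))"
proof -
  define E where "E p = erg_average j (reduction j f p) (\<lambda>_. m) - erg_average j (reduction j f p) (\<lambda>_. n)" for p
  let ?B = "(C * C) ^ j + (C * C) ^ j"
  have E: "bounded_by M ?B (E p)" for p
    unfolding E_def
    by (intro bounded_by_diff erg_average_reduction_bounded)
  have EE: "bounded_by M (?B * ?B) (E p * E p)" for p
    by (intro bounded_by_mult E)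
  let ?G = "glue k (\<lambda>p. E p * E p)"
  have G: "?G \<in> BI"
    using bounded_by_glue[OF EE] by (rule bounded_internalI)
  let ?X = "reduced_average j f N b m - reduced_average j f N b n"
  have X: "?X \<in> BI"
    by (intro bounded_internal_closed bounded_internalI[OF reduced_average_bounded[OF assms]])
  have "tr k (?X * ?X) \<le> tr (\<lambda>s. k s * N s) (scale (D\<^sup>2) ?G)"
  proof (rule tr_le[where e = "\<lambda>_. 0"])
    fix s
    have "mean k (?X * ?X) s \<le> mean k (scale (D\<^sup>2) (internal_average N (\<lambda>p. E p * E p))) s"
    proof (rule mean_mono)
      fix s w x
      let ?a = "\<lambda>p. b s w ((R (Suc j) ^^ p) x) * E p s w x"
      have "(?X * ?X) s w x = ((\<Sum>p=1..N s. ?a p) / N s)\<^sup>2"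
        by (simp add: reduced_average_def internal_average_def shift_def E_def power2_eq_square
            right_diff_distrib sum_subtractf diff_divide_distrib)
      also have "\<dots> \<le> (\<Sum>p=1..N s. (?a p)\<^sup>2) / N s"
        by (rule average_square_le)
      also have "\<dots> \<le> (\<Sum>p=1..N s. D\<^sup>2 * (E p s w x)\<^sup>2) / N s"
      proof (intro divide_right_mono sum_mono)
        fix p
        have "(b s w ((R (Suc j) ^^ p) x))\<^sup>2 \<le> D\<^sup>2"
          using bounded_byD(2,3)[OF assms] by (meson power2_le_iff_abs_le)
        then show "(?a p)\<^sup>2 \<le> D\<^sup>2 * (E p s w x)\<^sup>2"
          by (simp add: power_mult_distrib mult_right_mono)
      qed simp
      finally show "(?X * ?X) s w x \<le> scale (D\<^sup>2) (internal_average N (\<lambda>p. E p * E p)) s w x"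
        by (simp add: scale_def internal_average_def power2_eq_square sum_distrib_left)
    qed (intro bounded_internal_closed X bounded_internalI[OF bounded_by_average[OF EE]])+
    then show "mean k (?X * ?X) s \<le> mean (\<lambda>s. k s * N s) (scale (D\<^sup>2) ?G) s + 0"
      by (simp add: mean_scale mean_glue[OF EE])
  qed (auto intro!: bounded_internal_closed X G)
  also have "\<dots> = D\<^sup>2 * tr (\<lambda>s. k s * N s) ?G"
    by (rule tr_scale[OF G])
  also have "?G = (glue k E) * (glue k E)"
    by (simp add: fun_eq_iff glue_def)
  also have "glue k E = erg_average j (\<lambda>i. glue k (\<lambda>m. reduction j f m i)) (\<lambda>_. m)
       - erg_average j (\<lambda>i. glue k (\<lambda>m. reduction j f m i)) (\<lambda>_. n)"
    unfolding erg_average_glue by (simp add: fun_eq_iff glue_def E_def)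
  finally show ?thesis unfolding sqnorm_def .
qed

text \<open>The squares of the two differences differ by sum times difference: a bounded factor and
  one of order \<open>1 / N s\<close>, which vanishes along \<open>U\<close>.\<close>

lemma sqnorm_last_average_dual_diff:
  assumes b: "bounded_by M D b" and k: "\<And>s. 0 < k s" and N: "\<And>s. 0 < N s"
    and N_lim: "filterlim N at_top U"
  shows "sqnorm k (last_average j f (\<lambda>_. m) (dual_average j f N b)
        - last_average j f (\<lambda>_. n) (dual_average j f N b))
    \<le> sqnorm k (reduced_average j f N b m - reduced_average j f N b n)"
proof -
  let ?X = "last_average j f (\<lambda>_. m) (dual_average j f N b) - last_average j f (\<lambda>_. n) (dual_average j f N b)"
  let ?Y = "reduced_average j f N b m - reduced_average j f N b n"
  have bd: "bounded_by M (D * C ^ j) (dual_average j f N b)"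
    by (rule dual_average_bounded) (use f_bounded C_nonneg b in auto)
  have la: "bounded_by M (C ^ j * (D * C ^ j)) (last_average j f (\<lambda>_. n) (dual_average j f N b))" for n
    by (rule last_average_bounded) (use f_bounded C_nonneg bd in auto)
  have X: "?X \<in> BI" and Y: "?Y \<in> BI"
    by (intro bounded_internal_closed bounded_internalI[OF la] bounded_internalI[OF reduced_average_bounded[OF b]])+
  obtain K1 K2 where K: "bounded_by M K1 ?X" "bounded_by M K2 ?Y"
    using X Y by (auto elim!: bounded_internalE)
  \<comment> \<open>\<open>K1 + K2\<close> bounds the sum; the second factor adds the errors for
    lengths \<open>m\<close> and \<open>n\<close>, with \<open>1 / N s\<close> taken out.\<close>
  define c where "c = (K1 + K2) * (C ^ j * (2 * m * (D * C ^ j)) + C ^ j * (2 * n * (D * C ^ j)))"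
  have c: "0 \<le> c"
    using bounded_byD(3)[OF K(1)] bounded_byD(3)[OF K(2)] bounded_byD(3)[OF b] C_nonneg
    by (simp add: c_def)
  let ?e = "\<lambda>s w x. c / N s"
  have e: "?e \<in> BI"
  proof (rule bounded_internalI[of _ c])
    have "c / N s \<le> c" for s using N[of s] c by (simp add: divide_le_eq mult_le_cancel_left1)
    then show "bounded_by M c ?e" using c by (simp add: bounded_by_def)
  qed
  have "tr k (?X * ?X) \<le> tr k (?Y * ?Y)"
  proof (rule tr_le[where e = "\<lambda>s. c / N s"])
    show "((\<lambda>s. c / N s) \<longlongrightarrow> 0) U"
      by (intro tendsto_divide_0[OF tendsto_const] filterlim_at_top_imp_at_infinity
          filterlim_compose[OF filterlim_real_sequentially N_lim])
    fix s
    have "mean k (?X * ?X) s \<le> mean k (?Y * ?Y + ?e) s"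
    proof (rule mean_mono)
      fix s w x
      let ?x = "?X s w x" and ?y = "?Y s w x"
      have "\<bar>?x - ?y\<bar> \<le> C ^ j * (2 * m * (D * C ^ j) / N s) + C ^ j * (2 * n * (D * C ^ j) / N s)"
        using last_average_dual_close[OF b, of m N s w x] last_average_dual_close[OF b, of n N s w x]
        by simp
      moreover have "\<bar>?x + ?y\<bar> \<le> K1 + K2"
        using bounded_byD(2)[OF K(1), of s w x] bounded_byD(2)[OF K(2), of s w x] by linarith
      ultimately have "\<bar>?x + ?y\<bar> * \<bar>?x - ?y\<bar>
          \<le> (K1 + K2) * (C ^ j * (2 * m * (D * C ^ j) / N s) + C ^ j * (2 * n * (D * C ^ j) / N s))"
        by (intro mult_mono) auto
      also have "\<dots> = c / N s"
        by (simp add: c_def add_divide_distrib distrib_left)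
      finally have "(?x + ?y) * (?x - ?y) \<le> c / N s"
        unfolding abs_mult[symmetric] by linarith
      then show "(?X * ?X) s w x \<le> (?Y * ?Y + ?e) s w x"
        unfolding times_fun_apply plus_fun_apply by (simp only: algebra_simps)
    qed (intro bounded_internal_closed X Y e)+
    also have "\<dots> = mean k (?Y * ?Y) s + mean k ?e s"
      by (intro mean_linear bounded_internal_closed Y e)
    also have "mean k ?e s = c / N s"
      using k[of s] by (simp add: mean_def prob_space)
    finally show "mean k (?X * ?X) s \<le> mean k (?Y * ?Y) s + c / N s" .
  qed (intro bounded_internal_closed X Y)+
  then show ?thesis by (simp add: sqnorm_def)
qed

lemma mean_cauchy_dual_average:
  assumes conv: "averages_converge j" and b: "b \<in> BI" and k: "\<And>s. 0 < k s"
    and N: "\<And>s. 0 < N s" and N_lim: "filterlim N at_top U"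
  shows "mean_cauchy k (\<lambda>n. last_average j f (\<lambda>_. n) (dual_average j f N b))"
proof -
  obtain D where D: "bounded_by M D b" using b by (rule bounded_internalE)
  \<comment> \<open>Bounds are known only for indices in \<open>{1..j}\<close>, while the induction
    hypothesis asks for all; the other functions do not enter the product and are set to 0.\<close>
  define h where "h i = (if i \<in> {1..j} then glue k (\<lambda>m. reduction j f m i) else (\<lambda>s w x. 0))" for i
  let ?h = "\<lambda>i. glue k (\<lambda>m. reduction j f m i)"
  have "h i \<in> BI" for i
    by (auto simp: h_def bounded_internal_const intro!: bounded_internalI[OF bounded_by_glue[OF reduction_bounded]])
  then have "mean_cauchy (\<lambda>s. k s * N s) (\<lambda>n. erg_average j h (\<lambda>_. n))"
    using conv k N unfolding averages_converge_def by simp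
  moreover have "prod_shift j h n = prod_shift j ?h n" for n
    unfolding prod_shift_def by (intro ext prod.cong) (simp_all add: h_def)
  then have "erg_average j h N = erg_average j ?h N" for N
    unfolding erg_average_def by presburger
  ultimately have cauchy: "mean_cauchy (\<lambda>s. k s * N s) (\<lambda>n. erg_average j ?h (\<lambda>_. n))"
    by simp
  have D1: "D\<^sup>2 + 1 > 0" by (simp add: add_nonneg_pos)
  have bound: "sqnorm k (last_average j f (\<lambda>_. m) (dual_average j f N b)
        - last_average j f (\<lambda>_. n) (dual_average j f N b))
      \<le> D\<^sup>2 * sqnorm (\<lambda>s. k s * N s) (erg_average j ?h (\<lambda>_. m) - erg_average j ?h (\<lambda>_. n))" for m n
    using sqnorm_last_average_dual_diff[where k = k, OF D k N N_lim, where m = m and n = n]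
      sqnorm_reduced_average_diff_le[OF D, where k = k and N = N and m = m and n = n] by linarith
  show ?thesis
    unfolding mean_cauchy_def
  proof (intro allI impI)
    fix e :: real assume "e > 0"
    with D1 have "e / (D\<^sup>2 + 1) > 0" by simp
    from cauchy[unfolded mean_cauchy_def, rule_format, OF this] obtain n0 where
      n0: "\<And>m n. m \<ge> n0 \<Longrightarrow> n \<ge> n0 \<Longrightarrow>
        sqnorm (\<lambda>s. k s * N s) (erg_average j ?h (\<lambda>_. m) - erg_average j ?h (\<lambda>_. n)) \<le> e / (D\<^sup>2 + 1)"
      by auto
    show "\<exists>n0. \<forall>m\<ge>n0. \<forall>n\<ge>n0. sqnorm k (last_average j f (\<lambda>_. m) (dual_average j f N b)
        - last_average j f (\<lambda>_. n) (dual_average j f N b)) \<le> e"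
    proof (intro exI[of _ n0] allI impI)
      fix m n assume "n0 \<le> m" "n0 \<le> n"
      from mult_left_mono[OF n0[OF this], of "D\<^sup>2"] bound[of m n]
      have "sqnorm k (last_average j f (\<lambda>_. m) (dual_average j f N b)
        - last_average j f (\<lambda>_. n) (dual_average j f N b)) \<le> D\<^sup>2 * (e / (D\<^sup>2 + 1))" by simp
      also have "\<dots> \<le> e" using \<open>e > 0\<close> D1 by (simp add: field_simps)
      finally show "sqnorm k (last_average j f (\<lambda>_. m) (dual_average j f N b)
        - last_average j f (\<lambda>_. n) (dual_average j f N b)) \<le> e" .
    qed
  qed
qed

end

end

subsection \<open>Convergence for internal functions\<close>

context commuting_system
begin

context
  fixes j :: nat and f :: "nat \<Rightarrow> 'a internal" and C :: real and k :: "nat \<Rightarrow> nat"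
    and g :: "'a internal"
  assumes f_bounded: "\<And>i. i \<in> {1..j} \<Longrightarrow> bounded_by M C (f i)" and C_nonneg: "0 \<le> C"
    and k_pos: "\<And>s. 0 < k s" and g_BI: "g \<in> BI" and conv: "averages_converge j"
begin

private definition V :: "'a internal set" where
  "V = {v \<in> BI. mean_cauchy k (\<lambda>n. last_average j f (\<lambda>_. n) v)}"

text \<open>The squared distance from \<open>g\<close> to \<open>V\<close>. Attainment is not
  established; the argument works with near minimizers.\<close>

private definition \<delta> :: real where
  "\<delta> = (INF v\<in>V. sqnorm k (g - v))"

private lemma V_BI: "v \<in> V \<Longrightarrow> v \<in> BI"
  by (simp add: V_def)

private lemma diff_BI: "v \<in> V \<Longrightarrow> g - v \<in> BI"
  by (intro bounded_internal_closed g_BI V_BI)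

private lemma last_BI: "h \<in> BI \<Longrightarrow> last_average j f N h \<in> BI"
  by (rule last_average_BI) (use f_bounded C_nonneg in auto)

private lemma V_add: "v \<in> V \<Longrightarrow> w \<in> V \<Longrightarrow> v + w \<in> V"
  unfolding V_def
  by (auto simp: last_average_linear intro!: bounded_internal_closed mean_cauchy_add last_BI)

private lemma V_scale: "v \<in> V \<Longrightarrow> scale c v \<in> V"
  unfolding V_def
  by (auto simp: last_average_linear intro!: bounded_internal_closed mean_cauchy_scale last_BI)

private lemma V_zero: "(\<lambda>s w x. 0) \<in> V"
proof -
  have "last_average j f (\<lambda>_. n) (\<lambda>s w x. 0) = (\<lambda>s w x. 0)" for n
    by (simp add: fun_eq_iff last_average_def internal_average_def shift_def)
  moreover have "sqnorm k ((\<lambda>s w x. 0) - (\<lambda>s w x. 0)) = 0"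
    unfolding sqnorm_def
    by (rule tr_eqI) (simp_all add: times_fun_def fun_diff_def bounded_internal_const mean_def[abs_def])
  ultimately show ?thesis by (simp add: V_def bounded_internal_const mean_cauchy_def)
qed

private lemma \<delta>_le: "v \<in> V \<Longrightarrow> \<delta> \<le> sqnorm k (g - v)"
  unfolding \<delta>_def
  by (rule cINF_lower)
    (auto intro!: bdd_belowI[of _ 0] sqnorm_nonneg diff_BI)

private lemma near_minimizer:
  assumes "e > 0"
  obtains v where "v \<in> V" "sqnorm k (g - v) < \<delta> + e"
proof -
  have "bdd_below ((\<lambda>v. sqnorm k (g - v)) ` V)"
    by (auto intro!: bdd_belowI[of _ 0] sqnorm_nonneg diff_BI)
  then have "\<exists>v\<in>V. sqnorm k (g - v) < \<delta> + e"
    using cINF_less_iff[of V "\<lambda>v. sqnorm k (g - v)" "\<delta> + e"] assms V_zero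
    by (auto simp: \<delta>_def)
  with that show ?thesis by blast
qed

text \<open>As for projections in Hilbert space: the midpoint of \<open>v\<close> and
  \<open>w\<close> lies in \<open>V\<close>, so the sum of the remainders has squared seminorm at
  least \<open>4 * \<delta>\<close>, and the parallelogram law applies.\<close>

private lemma sqnorm_minimizers_diff:
  assumes "v \<in> V" "w \<in> V"
  shows "sqnorm k ((g - v) - (g - w)) \<le> 2 * (sqnorm k (g - v) - \<delta>) + 2 * (sqnorm k (g - w) - \<delta>)"
proof -
  have BI: "g - v \<in> BI" "g - w \<in> BI"
    using assms by (auto intro: diff_BI V_BI)
  have "scale (1/2) (v + w) \<in> V" by (intro V_scale V_add assms)
  then have "\<delta> \<le> sqnorm k (g - scale (1/2) (v + w))" by (rule \<delta>_le)
  moreover have "g - scale (1/2) (v + w) = scale (1/2) ((g - v) + (g - w))"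
    by (simp add: fun_eq_iff scale_def field_simps)
  moreover have "sqnorm k (scale (1/2) ((g - v) + (g - w))) = (1/2)\<^sup>2 * sqnorm k ((g - v) + (g - w))"
    by (intro sqnorm_scale bounded_internal_closed BI)
  ultimately have "4 * \<delta> \<le> sqnorm k ((g - v) + (g - w))"
    by (simp only: power2_eq_square)
  then show ?thesis
    unfolding sqnorm_parallelogram[OF BI] by argo
qed

text \<open>Almost orthogonality to \<open>V\<close>, obtained by comparing \<open>v\<close> with
  the competitor \<open>v + scale t h\<close> and expanding the square.\<close>

private lemma tr_minimizer_le:
  assumes "v \<in> V" "h \<in> V"
  shows "2 * t * tr k ((g - v) * h) \<le> sqnorm k (g - v) - \<delta> + t\<^sup>2 * sqnorm k h"
proof -
  have BI: "g - v \<in> BI" "h \<in> BI"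
    using assms by (auto intro: diff_BI V_BI)
  have "v + scale t h \<in> V" by (intro V_scale V_add assms)
  then have "\<delta> \<le> sqnorm k (g - (v + scale t h))" by (rule \<delta>_le)
  moreover have "g - (v + scale t h) = (g - v) - scale t h"
    by (simp add: algebra_simps)
  moreover have "sqnorm k ((g - v) - scale t h) = sqnorm k (g - v) - 2 * tr k ((g - v) * scale t h) + t\<^sup>2 * sqnorm k h"
    by (simp add: sqnorm_diff sqnorm_scale BI bounded_internal_closed)
  moreover have "(g - v) * scale t h = scale t ((g - v) * h)"
    by (simp add: fun_eq_iff scale_def)
  moreover have "tr k (scale t ((g - v) * h)) = t * tr k ((g - v) * h)"
    by (intro tr_scale bounded_internal_closed BI)
  ultimately show ?thesis by (simp only:)
qed

text \<open>Otherwise \<open>g - v0\<close> correlates with a dual function \<open>\<sigma>\<close>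
  in \<open>V\<close>. How near the minimum must be for a contradiction depends on
  \<open>\<sigma>\<close>, which depends on \<open>v0\<close>. So a better \<open>v\<close> is
  chosen after \<open>\<sigma>\<close>, and \<open>sqnorm_minimizers_diff\<close> controls the
  change from \<open>v0\<close> to \<open>v\<close>.\<close>

private lemma last_average_minimizer_small:
  assumes \<eta>: "\<eta> > 0" and v0: "v0 \<in> V"
    and min: "2 * (C ^ j)\<^sup>2 * (sqnorm k (g - v0) - \<delta>) \<le> \<eta> / 4"
  shows "\<exists>n0. \<forall>n\<ge>n0. sqnorm k (last_average j f (\<lambda>_. n) (g - v0)) \<le> \<eta>"
proof (rule ccontr)
  assume "\<not> ?thesis"
  then have bad: "\<exists>n\<ge>n0. \<eta> < sqnorm k (last_average j f (\<lambda>_. n) (g - v0))" for n0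
    by (auto simp: not_le)
  let ?u0 = "g - v0" and ?c = "C ^ j"
  let ?A = "\<lambda>n. last_average j f (\<lambda>_. n) ?u0"
  have u0: "?u0 \<in> BI" by (intro bounded_internal_closed g_BI V_BI v0)
  \<comment> \<open>The bound by \<open>s\<close> leaves finitely many candidates at each stage, and
    \<open>1 \<le> n\<close> keeps the chosen length positive.\<close>
  define Q where "Q s n \<longleftrightarrow> 1 \<le> n \<and> n \<le> s \<and> \<eta> < mean k (?A n * ?A n) s" for s n
  \<comment> \<open>The largest bad length visible at stage \<open>s\<close>; since there are arbitrarily large bad lengths,
    it tends to infinity along \<open>U\<close>.\<close>
  define N where "N s = (if \<exists>n. Q s n then Max {n. Q s n} else 1)" for s
  have fin: "finite {n. Q s n}" for s
    by (rule finite_subset[of _ "{..s}"]) (auto simp: Q_def)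
  have N: "Q s (N s) \<and> n \<le> N s" if "Q s n" for s n
    using Max_in[OF fin, of s] Max_ge[OF fin, of n s] that by (auto simp: N_def)
  have N_pos: "0 < N s" for s
  proof (cases "\<exists>n. Q s n")
    case True
    then have "Q s (N s)" using N by blast
    then show ?thesis by (simp add: Q_def)
  qed (simp add: N_def)
  have ev: "eventually (\<lambda>s. Q s (N s) \<and> n0 \<le> N s) U" for n0
  proof -
    obtain n where n: "max n0 1 \<le> n" "\<eta> < sqnorm k (?A n)" using bad by blast
    have "(mean k (?A n * ?A n) \<longlongrightarrow> sqnorm k (?A n)) U"
      unfolding sqnorm_def by (intro tr_tendsto bounded_internal_closed last_BI u0)
    then have "eventually (\<lambda>s. \<eta> < mean k (?A n * ?A n) s) U"
      using n(2) by (rule order_tendstoD)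
    moreover have "eventually (\<lambda>s. n \<le> s) U"
      using le_sequentially eventually_ge_at_top by (rule filter_leD)
    ultimately show ?thesis
    proof eventually_elim
      case (elim s)
      then have "Q s n" using n(1) by (simp add: Q_def)
      from N[OF this] n(1) show ?case by auto
    qed
  qed
  have N_lim: "filterlim N at_top U"
    unfolding filterlim_at_top
  proof (intro allI)
    show "eventually (\<lambda>s. n0 \<le> N s) U" for n0 using ev[of n0] by eventually_elim simp
  qed
  let ?b = "last_average j f N ?u0"
  have b: "?b \<in> BI" by (rule last_BI[OF u0])
  have b_ge: "\<eta> \<le> sqnorm k ?b"
  proof (rule tendsto_lowerbound[OF _ _ proper])
    show "(mean k (?b * ?b) \<longlongrightarrow> sqnorm k ?b) U"
      unfolding sqnorm_def by (intro tr_tendsto bounded_internal_closed b)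
    show "eventually (\<lambda>s. \<eta> \<le> mean k (?b * ?b) s) U"
      using ev[of 0]
    proof eventually_elim
      case (elim s)
      \<comment> \<open>The mean at stage \<open>s\<close> sees only that stage, where the length is
        the number \<open>N s\<close>.\<close>
      have "mean k (?b * ?b) s = mean k (?A (N s) * ?A (N s)) s"
        by (simp add: mean_def last_average_def internal_average_def)
      with elim show ?case by (simp add: Q_def)
    qed
  qed
  define \<sigma> where "\<sigma> = dual_average j f N ?b"
  have "\<sigma> \<in> V"
    unfolding V_def \<sigma>_def
    using dual_average_BI[OF f_bounded C_nonneg b]
      mean_cauchy_dual_average[OF f_bounded C_nonneg conv b k_pos N_pos N_lim] by simp
  then have \<sigma>: "\<sigma> \<in> BI" by (rule V_BI)
  have adj: "tr k (\<sigma> * h) = tr k (?b * last_average j f N h)" if "h \<in> BI" for h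
    unfolding \<sigma>_def by (rule dual_average_adjoint[OF f_bounded C_nonneg b that])
  \<comment> \<open>By duality the left side is the correlation of \<open>\<sigma>\<close> with
    \<open>?u0\<close>. Split \<open>?u0\<close> into \<open>g - v\<close> and \<open>d\<close>,
    move \<open>\<sigma>\<close> back to an average of \<open>d\<close>, and absorb half of the
    doubled left side by \<open>tr_mult_le\<close>.\<close>
  have key: "sqnorm k ?b \<le> 2 * tr k ((g - v) * \<sigma>) + ?c\<^sup>2 * sqnorm k (?u0 - (g - v))" if v: "v \<in> V" for v
  proof -
    have u: "g - v \<in> BI" by (intro bounded_internal_closed g_BI V_BI v)
    define d where "d = ?u0 - (g - v)"
    have d: "d \<in> BI" unfolding d_def by (intro bounded_internal_closed u u0)
    have "sqnorm k ?b = tr k (\<sigma> * ?u0)"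
      by (simp add: sqnorm_def adj u0)
    moreover have "\<sigma> * ?u0 = (g - v) * \<sigma> + \<sigma> * d"
      by (simp add: d_def algebra_simps)
    moreover have "tr k ((g - v) * \<sigma> + \<sigma> * d) = tr k ((g - v) * \<sigma>) + tr k (?b * last_average j f N d)"
      unfolding adj[OF d, symmetric] by (intro tr_linear bounded_internal_closed u d \<sigma>)
    ultimately have "sqnorm k ?b = tr k ((g - v) * \<sigma>) + tr k (?b * last_average j f N d)"
      by (simp only:)
    then have "2 * sqnorm k ?b \<le> 2 * tr k ((g - v) * \<sigma>) + sqnorm k ?b + sqnorm k (last_average j f N d)"
      using tr_mult_le[OF b last_BI[OF d, of N], of k] by argo
    moreover have "sqnorm k (last_average j f N d) \<le> ?c\<^sup>2 * sqnorm k d"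
      by (rule sqnorm_last_average_le[OF f_bounded C_nonneg d])
    ultimately show ?thesis unfolding d_def[symmetric] by linarith
  qed
  define D where "D = sqnorm k \<sigma> + 1"
  have D: "D \<ge> 1" using sqnorm_nonneg[OF \<sigma>] by (simp add: D_def)
  \<comment> \<open>Here \<open>t * D = \<eta> / 4\<close>. With
    \<open>e \<le> t * \<eta> / 8\<close>, division by \<open>t\<close> bounds the doubled
    correlation by \<open>3 * \<eta> / 8\<close>; the second bound on \<open>e\<close> makes
    \<open>2 * ?c\<^sup>2 * e\<close> at most \<open>\<eta> / 8\<close>.\<close>
  define t where "t = \<eta> / (4 * D)"
  have t: "t > 0" using \<eta> D by (simp add: t_def)
  define e where "e = min (t * \<eta> / 8) (\<eta> / (16 * (?c\<^sup>2 + 1)))"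
  have c1: "?c\<^sup>2 + 1 > 0" by (simp add: add_nonneg_pos)
  have e: "e > 0" using t \<eta> c1 by (simp add: e_def)
  have e_le: "e \<le> t * \<eta> / 8" "e \<le> \<eta> / (16 * (?c\<^sup>2 + 1))"
    unfolding e_def by (rule min.cobounded1, rule min.cobounded2)
  obtain v where v: "v \<in> V" "sqnorm k (g - v) < \<delta> + e"
    using near_minimizer[OF e] by blast
  have "2 * t * tr k ((g - v) * \<sigma>) \<le> e + t\<^sup>2 * sqnorm k \<sigma>"
    using tr_minimizer_le[OF v(1) \<open>\<sigma> \<in> V\<close>, of t] v(2) by linarith
  also have "\<dots> \<le> t * \<eta> / 8 + t\<^sup>2 * D"
    by (intro add_mono mult_left_mono e_le) (simp_all add: D_def)
  also have "\<dots> = t * (3 * \<eta> / 8)"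
    using D by (simp add: t_def field_simps power2_eq_square)
  finally have 1: "2 * tr k ((g - v) * \<sigma>) \<le> 3 * \<eta> / 8"
    using t by (simp add: mult.assoc mult.left_commute[of 2])
  define a X where "a = sqnorm k ?u0 - \<delta>" and "X = sqnorm k (?u0 - (g - v))"
  have "X \<le> 2 * a + 2 * (sqnorm k (g - v) - \<delta>)"
    unfolding a_def X_def by (rule sqnorm_minimizers_diff[OF v0 v(1)])
  then have "X \<le> 2 * a + 2 * e"
    using v(2) by argo
  then have "?c\<^sup>2 * X \<le> ?c\<^sup>2 * (2 * a + 2 * e)"
    by (intro mult_left_mono) simp_all
  also have "\<dots> = 2 * ?c\<^sup>2 * a + 2 * (?c\<^sup>2 * e)"
    by (simp add: algebra_simps)
  finally have 2: "?c\<^sup>2 * X \<le> 2 * ?c\<^sup>2 * a + 2 * (?c\<^sup>2 * e)" .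
  have "?c\<^sup>2 * e \<le> (?c\<^sup>2 + 1) * (\<eta> / (16 * (?c\<^sup>2 + 1)))"
    using e by (intro mult_mono e_le) simp_all
  also have "\<dots> = \<eta> / 16" using c1 by (simp add: field_simps)
  \<comment> \<open>The three contributions \<open>3 * \<eta> / 8\<close>, \<open>\<eta> / 4\<close>
    and \<open>\<eta> / 8\<close> add up to less than \<open>\<eta>\<close>.\<close>
  finally show False
    using key[OF v(1), folded X_def] min[folded a_def] b_ge 1 2 \<eta> by argo
qed

lemma mean_cauchy_last_average: "mean_cauchy k (\<lambda>n. last_average j f (\<lambda>_. n) g)"
  unfolding mean_cauchy_def
proof (intro allI impI)
  fix e :: real assume e: "e > 0"
  let ?c = "(C ^ j)\<^sup>2"
  have c1: "?c + 1 > 0" by (simp add: add_nonneg_pos)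
  \<comment> \<open>Chosen so that the preceding lemma applies with \<open>e / 16\<close>. The final
    budget is \<open>2 * (e / 4)\<close> for the part in \<open>V\<close> and
    \<open>2 * (4 * (e / 16))\<close> for the remainder, in total \<open>e\<close>.\<close>
  define \<theta> where "\<theta> = e / (128 * (?c + 1))"
  have \<theta>: "\<theta> > 0" using e c1 by (simp add: \<theta>_def)
  obtain v where v: "v \<in> V" "sqnorm k (g - v) < \<delta> + \<theta>" using near_minimizer[OF \<theta>] by blast
  have "?c * (sqnorm k (g - v) - \<delta>) \<le> (?c + 1) * \<theta>"
    using v \<delta>_le[OF v(1)] by (intro mult_mono) auto
  also have "\<dots> = e / 128"
  proof -
    have "p * (e / (128 * p)) = e / 128" if "p > 0" for p :: real using that by simp
    from this[OF c1] show ?thesis by (simp only: \<theta>_def)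
  qed
  finally have "2 * ?c * (sqnorm k (g - v) - \<delta>) \<le> (e / 16) / 4" by simp
  then obtain n1 where n1: "\<And>n. n \<ge> n1 \<Longrightarrow> sqnorm k (last_average j f (\<lambda>_. n) (g - v)) \<le> e / 16"
    using last_average_minimizer_small[of "e / 16", OF _ v(1)] e by auto
  have e4: "e / 4 > 0" using e by simp
  from v(1) have "mean_cauchy k (\<lambda>n. last_average j f (\<lambda>_. n) v)" by (simp add: V_def)
  from this[unfolded mean_cauchy_def, rule_format, OF e4] obtain n2 where n2: "\<And>m n. m \<ge> n2 \<Longrightarrow> n \<ge> n2 \<Longrightarrow>
      sqnorm k (last_average j f (\<lambda>_. m) v - last_average j f (\<lambda>_. n) v) \<le> e / 4"
    by auto
  have gv: "g - v \<in> BI" by (intro bounded_internal_closed g_BI V_BI v)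
  show "\<exists>n0. \<forall>m\<ge>n0. \<forall>n\<ge>n0. sqnorm k (last_average j f (\<lambda>_. m) g - last_average j f (\<lambda>_. n) g) \<le> e"
  proof (intro exI[of _ "max n1 n2"] allI impI)
    fix m n assume mn: "max n1 n2 \<le> m" "max n1 n2 \<le> n"
    let ?V = "\<lambda>n. last_average j f (\<lambda>_. n) v" and ?W = "\<lambda>n. last_average j f (\<lambda>_. n) (g - v)"
    have BI: "?V n \<in> BI" "?W n \<in> BI" for n by (intro last_BI V_BI v gv)+
    have "last_average j f (\<lambda>_. m) g - last_average j f (\<lambda>_. n) g = (?V m - ?V n) + (?W m - ?W n)"
      by (simp add: last_average_linear algebra_simps)
    then have "sqnorm k (last_average j f (\<lambda>_. m) g - last_average j f (\<lambda>_. n) g)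
        = sqnorm k ((?V m - ?V n) + (?W m - ?W n))" by (simp only:)
    moreover have "sqnorm k ((?V m - ?V n) + (?W m - ?W n))
        \<le> 2 * sqnorm k (?V m - ?V n) + 2 * sqnorm k (?W m - ?W n)"
      by (intro sqnorm_add_le bounded_internal_closed BI)
    moreover have "sqnorm k (?W m - ?W n) \<le> 2 * sqnorm k (?W m) + 2 * sqnorm k (?W n)"
      by (intro sqnorm_diff_le BI)
    moreover have "sqnorm k (?W m) \<le> e / 16" "sqnorm k (?W n) \<le> e / 16"
      "sqnorm k (?V m - ?V n) \<le> e / 4"
      using n1 n2 mn by simp_all
    ultimately show "sqnorm k (last_average j f (\<lambda>_. m) g - last_average j f (\<lambda>_. n) g) \<le> e"
      by argo
  qed
qed

end

lemma averages_converge: "averages_converge j"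
proof (induction j)
  case 0
  show ?case
    unfolding averages_converge_def mean_cauchy_def
  proof (intro allI impI)
    fix k f and e :: real
    assume "e > 0"
    \<comment> \<open>The empty product is 1. Length 0 gives 0 instead, hence the threshold
      1.\<close>
    have "erg_average 0 f (\<lambda>_. n) = (\<lambda>s w x. 1)" if "n \<ge> 1" for n
      using that by (simp add: erg_average_def internal_average_def prod_shift_def)
    then have "erg_average 0 f (\<lambda>_. m) - erg_average 0 f (\<lambda>_. n) = (\<lambda>s w x. 0)" if "m \<ge> 1" "n \<ge> 1" for m n
      using that by (simp add: zero_fun_def)
    moreover have "sqnorm k (\<lambda>s w x. 0) = 0"
      unfolding sqnorm_def
      by (rule tr_eqI) (simp_all add: times_fun_def zero_fun_def bounded_internal_const mean_def[abs_def])
    ultimately show "\<exists>n0. \<forall>m\<ge>n0. \<forall>n\<ge>n0. sqnorm k (erg_average 0 f (\<lambda>_. m) - erg_average 0 f (\<lambda>_. n)) \<le> e"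
      using \<open>e > 0\<close> by (intro exI[of _ 1]) auto
  qed
next
  case (Suc j)
  show ?case
    unfolding averages_converge_def
  proof (intro allI impI)
    fix k :: "nat \<Rightarrow> nat" and f :: "nat \<Rightarrow> 'a internal" assume k: "\<forall>s. 0 < k s" and f: "\<forall>i. f i \<in> BI"
    then obtain C where C: "\<And>i. bounded_by M (C i) (f i)"
      unfolding bounded_internal_def by simp metis
    define C' where "C' = (\<Sum>i=1..j. C i)"
    have "C i \<ge> 0" for i using bounded_byD(3)[OF C] .
    then have "C i \<le> C'" if "i \<in> {1..j}" for i
      unfolding C'_def using that by (intro member_le_sum) auto
    then have "bounded_by M C' (f i)" if "i \<in> {1..j}" for i
      using C that bounded_by_mono by blast
    moreover have "0 \<le> C'"
      unfolding C'_def by (intro sum_nonneg) (simp add: \<open>\<And>i. C i \<ge> 0\<close>)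
    ultimately show "mean_cauchy k (\<lambda>n. erg_average (Suc j) f (\<lambda>_. n))"
      unfolding erg_average_Suc using k f Suc by (intro mean_cauchy_last_average) auto
  qed
qed

end

subsection \<open>Convergence in mean square\<close>

text \<open>On a probability space the sequence is Cauchy in mean as well, so a subsequence
  converges almost everywhere; the uniform bound then permits dominated convergence.\<close>

lemma (in prob_space) bounded_L2_Cauchy_convergent:
  fixes F :: "nat \<Rightarrow> 'a \<Rightarrow> complex"
  assumes F[measurable]: "\<And>n. F n \<in> borel_measurable M"
    and bound: "\<And>n x. norm (F n x) \<le> C"
    and cauchy: "\<And>e. e > 0 \<Longrightarrow>
      \<exists>n0. \<forall>m\<ge>n0. \<forall>n\<ge>n0. (\<integral>x. (norm (F m x - F n x))\<^sup>2 \<partial>M) \<le> e"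
  obtains g where "g \<in> borel_measurable M" "AE x in M. norm (g x) \<le> C"
    "(\<lambda>n. \<integral>x. (norm (F n x - g x))\<^sup>2 \<partial>M) \<longlonglongrightarrow> 0"
proof -
  have C: "0 \<le> C" using order_trans[OF norm_ge_zero bound] .
  have diff_le: "norm (F m x - F n x) \<le> 2 * C" for m n x
    using norm_triangle_ineq4[of "F m x" "F n x"] bound[of m x] bound[of n x] by linarith
  have sq_le: "(norm (F m x - F n x))\<^sup>2 \<le> 4 * C\<^sup>2" for m n x
    using power_mono[OF diff_le, of m x n 2] by (simp add: power_mult_distrib)
  have int2: "integrable M (\<lambda>x. (norm (F m x - F n x))\<^sup>2)" for m n
    by (rule integrable_const_bound[of _ "4 * C\<^sup>2"]) (auto intro!: sq_le)
  have int1: "integrable M (\<lambda>x. norm (F m x - F n x))" for m n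
    by (rule integrable_const_bound[of _ "2 * C"]) (auto intro!: diff_le)
  \<comment> \<open>The difference of the two sides is a variance.\<close>
  have L1: "(\<integral>x. norm (F m x - F n x) \<partial>M)\<^sup>2 \<le> (\<integral>x. (norm (F m x - F n x))\<^sup>2 \<partial>M)" for m n
    using variance_positive[of "\<lambda>x. norm (F m x - F n x)"] variance_eq[OF int1 int2, of m n] by simp
  have "integrable M (F n)" for n
    by (rule integrable_const_bound[of _ C]) (auto intro!: bound)
  moreover have "\<exists>N. \<forall>i\<ge>N. \<forall>j\<ge>N. (\<integral>x. norm (F i x - F j x) \<partial>M) < e" if "e > 0" for e
  proof -
    have "(e / 2)\<^sup>2 > 0" using that by simp
    from cauchy[OF this] obtain N where
      N: "\<And>m n. m \<ge> N \<Longrightarrow> n \<ge> N \<Longrightarrow> (\<integral>x. (norm (F m x - F n x))\<^sup>2 \<partial>M) \<le> (e / 2)\<^sup>2"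
      by blast
    have "(\<integral>x. norm (F i x - F j x) \<partial>M) < e" if "i \<ge> N" "j \<ge> N" for i j
    proof -
      have "(\<integral>x. norm (F i x - F j x) \<partial>M) \<le> e / 2"
        using order_trans[OF L1 N[OF that]] \<open>e > 0\<close> by (simp add: power2_le_iff_abs_le)
      with \<open>e > 0\<close> show ?thesis by simp
    qed
    then show ?thesis by blast
  qed
  ultimately obtain r where r: "strict_mono r" "AE x in M. Cauchy (\<lambda>i. F (r i) x)"
    by (rule cauchy_L1_AE_cauchy_subseq) auto
  define g where "g x = lim (\<lambda>i. F (r i) x)" for x
  have g[measurable]: "g \<in> borel_measurable M"
    unfolding g_def by measurable
  have lim: "AE x in M. (\<lambda>i. F (r i) x) \<longlonglongrightarrow> g x"
    using r(2) by eventually_elim (simp add: g_def Cauchy_convergent_iff convergent_LIMSEQ_iff)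
  have "AE x in M. norm (g x) \<le> C"
    using lim
  proof eventually_elim
    case (elim x)
    show ?case by (rule tendsto_upperbound[OF tendsto_norm[OF elim]]) (simp_all add: bound)
  qed
  moreover have "(\<lambda>n. \<integral>x. (norm (F n x - g x))\<^sup>2 \<partial>M) \<longlonglongrightarrow> 0"
  proof (rule LIMSEQ_I)
    fix e :: real assume "e > 0"
    then have "e / 2 > 0" by simp
    from cauchy[OF this] obtain n0 where
      n0: "\<And>m n. m \<ge> n0 \<Longrightarrow> n \<ge> n0 \<Longrightarrow> (\<integral>x. (norm (F m x - F n x))\<^sup>2 \<partial>M) \<le> e / 2"
      by blast
    \<comment> \<open>Fix \<open>n\<close> in the Cauchy estimate and let the other index run along
      the subsequence.\<close>
    have "(\<integral>x. (norm (F n x - g x))\<^sup>2 \<partial>M) \<le> e / 2" if "n \<ge> n0" for n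
    proof (rule tendsto_upperbound)
      show "(\<lambda>i. \<integral>x. (norm (F n x - F (r i) x))\<^sup>2 \<partial>M) \<longlonglongrightarrow> (\<integral>x. (norm (F n x - g x))\<^sup>2 \<partial>M)"
      proof (rule integral_dominated_convergence[where w = "\<lambda>_. 4 * C\<^sup>2"])
        show "AE x in M. (\<lambda>i. (norm (F n x - F (r i) x))\<^sup>2) \<longlonglongrightarrow> (norm (F n x - g x))\<^sup>2"
          using lim by eventually_elim (intro tendsto_intros)
        show "AE x in M. norm ((norm (F n x - F (r i) x))\<^sup>2) \<le> 4 * C\<^sup>2" for i
          by (auto intro!: sq_le)
      qed auto
      have "r i \<ge> n0" if "i \<ge> n0" for i
        using that seq_suble[OF r(1), of i] by simp
      then show "\<forall>\<^sub>F i in sequentially. (\<integral>x. (norm (F n x - F (r i) x))\<^sup>2 \<partial>M) \<le> e / 2"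
        using n0[OF that] by (auto simp: eventually_sequentially)
    qed simp
    with \<open>e > 0\<close> show "\<exists>n0. \<forall>n\<ge>n0. norm ((\<integral>x. (norm (F n x - g x))\<^sup>2 \<partial>M) - 0) < e"
      by (force simp: Bochner_Integration.integral_nonneg)
  qed
  ultimately show ?thesis using that g by blast
qed

lemma norm_multiple_ergodic_average_le:
  fixes f :: "nat \<Rightarrow> 'a \<Rightarrow> complex"
  assumes bound: "\<And>i x. norm (f i x) \<le> C"
  shows "norm (multiple_ergodic_average l T f n x) \<le> C ^ l"
proof -
  have "norm (\<Prod>i=1..l. f i ((T i ^^ p) x)) \<le> C ^ l" for p
    using prod_mono[of "{1..l}" "\<lambda>i. norm (f i ((T i ^^ p) x))" "\<lambda>_. C"] bound
    by (simp add: prod_norm)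
  moreover have "0 \<le> C ^ l"
    using order_trans[OF norm_ge_zero bound] by simp
  ultimately have "\<bar>(\<Sum>p=1..n. norm (\<Prod>i=1..l. f i ((T i ^^ p) x))) / n\<bar> \<le> C ^ l"
    by (intro average_abs_le) simp_all
  moreover have "norm (multiple_ergodic_average l T f n x)
      \<le> (\<Sum>p=1..n. norm (\<Prod>i=1..l. f i ((T i ^^ p) x))) / n"
    by (simp add: multiple_ergodic_average_def norm_divide divide_right_mono norm_sum)
  ultimately show ?thesis by linarith
qed

section \<open>From internal functions to complex averages\<close>

context commuting_system
begin

definition real_average :: "nat \<Rightarrow> (nat \<Rightarrow> 'a \<Rightarrow> real) \<Rightarrow> nat \<Rightarrow> 'a \<Rightarrow> real" where
  "real_average l f n x = (\<Sum>p=1..n. \<Prod>i=1..l. f i ((T i ^^ p) x)) / n"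

text \<open>An ordinary function is an internal one constant in both indices. With families of size
  1 the seminorm is then the integral of the square.\<close>

lemma real_average_cauchy:
  assumes f: "\<And>i. f i \<in> borel_measurable M" and bound: "\<And>i x. \<bar>f i x\<bar> \<le> C" and "e > 0"
  shows "\<exists>n0. \<forall>m\<ge>n0. \<forall>n\<ge>n0. (\<integral>x. (real_average l f m x - real_average l f n x)\<^sup>2 \<partial>M) \<le> e"
proof -
  let ?f = "\<lambda>i (s::nat) (w::nat). f i"
  have f_BI: "?f i \<in> BI" for i
    by (rule bounded_internalI[of _ C]) (simp add: bounded_by_def f bound)
  then have "mean_cauchy (\<lambda>_. 1) (\<lambda>n. erg_average l ?f (\<lambda>_. n))"
    using averages_converge[of l] unfolding averages_converge_def by simp
  moreover have "sqnorm (\<lambda>_. 1) (erg_average l ?f (\<lambda>_. m) - erg_average l ?f (\<lambda>_. n))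
      = (\<integral>x. (real_average l f m x - real_average l f n x)\<^sup>2 \<partial>M)" for m n
    unfolding sqnorm_def
  proof (rule tr_eqI)
    have "\<bar>C\<bar> = C" using bound by (metis abs_ge_zero abs_of_nonneg order_trans)
    then have "erg_average l ?f N \<in> BI" for N
      by (intro bounded_internalI[OF erg_average_bounded[where C = C]])
        (auto simp: bounded_by_def f bound)
    then show "(erg_average l ?f (\<lambda>_. m) - erg_average l ?f (\<lambda>_. n))
        * (erg_average l ?f (\<lambda>_. m) - erg_average l ?f (\<lambda>_. n)) \<in> BI"
      by (intro bounded_internal_closed)
  qed (simp add: mean_def[abs_def] erg_average_def internal_average_def prod_shift_def
      real_average_def power2_eq_square times_fun_def fun_diff_def)
  ultimately show ?thesis using \<open>e > 0\<close> by (simp add: mean_cauchy_def)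
qed

lemma real_average_bounded:
  assumes f: "\<And>i. f i \<in> borel_measurable M" and bound: "\<And>i x. \<bar>f i x\<bar> \<le> C"
  shows "real_average l f n \<in> borel_measurable M" "\<bar>real_average l f n x\<bar> \<le> C ^ l"
proof -
  have [measurable]: "(\<lambda>x. f i ((T i ^^ p) x)) \<in> borel_measurable M" for i p
    by (rule measurable_compose[OF T_power(1) f])
  show "real_average l f n \<in> borel_measurable M"
    unfolding real_average_def[abs_def] by measurable
  have C: "0 \<le> C" using order_trans[OF abs_ge_zero bound] .
  have "\<bar>\<Prod>i=1..l. f i ((T i ^^ p) x)\<bar> \<le> (\<Prod>i=1..l. C)" for p
    unfolding abs_prod by (intro prod_mono) (simp add: bound)
  then show "\<bar>real_average l f n x\<bar> \<le> C ^ l"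
    unfolding real_average_def by (intro average_abs_le) (simp_all add: C)
qed

text \<open>Multiplies out real plus imaginary part in each factor; \<open>S\<close> is the set of
  factors contributing their real part.\<close>

lemma multiple_ergodic_average_expand:
  "multiple_ergodic_average l T f n x =
     (\<Sum>S\<in>Pow {1..l}. \<i> ^ card ({1..l} - S) * of_real
        (real_average l (\<lambda>i x. if i \<in> S then Re (f i x) else Im (f i x)) n x))"
proof -
  have "(\<Prod>i=1..l. f i ((T i ^^ p) x)) = (\<Sum>S\<in>Pow {1..l}. \<i> ^ card ({1..l} - S) * of_real
      (\<Prod>i=1..l. if i \<in> S then Re (f i ((T i ^^ p) x)) else Im (f i ((T i ^^ p) x))))" for p
  proof -
    let ?z = "\<lambda>i. f i ((T i ^^ p) x)"
    have "(\<Prod>i=1..l. ?z i) = (\<Prod>i=1..l. of_real (Re (?z i)) + \<i> * of_real (Im (?z i)))"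
      by (simp add: complex_eq[symmetric])
    also have "\<dots> = (\<Sum>S\<in>Pow {1..l}. (\<Prod>i\<in>S. of_real (Re (?z i))) * (\<Prod>i\<in>{1..l}-S. \<i> * of_real (Im (?z i))))"
      by (rule prod_add) simp
    also have "\<dots> = (\<Sum>S\<in>Pow {1..l}. \<i> ^ card ({1..l} - S) * of_real
        (\<Prod>i=1..l. if i \<in> S then Re (?z i) else Im (?z i)))"
    proof (rule sum.cong[OF refl])
      fix S assume "S \<in> Pow {1..l}"
      then have S: "{1..l} \<inter> S = S" "{1..l} \<inter> - S = {1..l} - S" by auto
      have "(\<Prod>i=1..l. if i \<in> S then Re (?z i) else Im (?z i))
          = (\<Prod>i\<in>S. Re (?z i)) * (\<Prod>i\<in>{1..l}-S. Im (?z i))"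
        using S by (simp add: prod.If_cases)
      then show "(\<Prod>i\<in>S. of_real (Re (?z i))) * (\<Prod>i\<in>{1..l}-S. \<i> * of_real (Im (?z i)))
          = \<i> ^ card ({1..l} - S) * of_real (\<Prod>i=1..l. if i \<in> S then Re (?z i) else Im (?z i))"
        by (simp add: prod.distrib)
    qed
    finally show ?thesis .
  qed
  then have "multiple_ergodic_average l T f n x = (\<Sum>p=1..n. \<Sum>S\<in>Pow {1..l}. \<i> ^ card ({1..l} - S) * of_real
      (\<Prod>i=1..l. if i \<in> S then Re (f i ((T i ^^ p) x)) else Im (f i ((T i ^^ p) x)))) / of_nat n"
    by (simp add: multiple_ergodic_average_def)
  also have "\<dots> = (\<Sum>S\<in>Pow {1..l}. \<Sum>p=1..n. \<i> ^ card ({1..l} - S) * of_real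
      (\<Prod>i=1..l. if i \<in> S then Re (f i ((T i ^^ p) x)) else Im (f i ((T i ^^ p) x)))) / of_nat n"
    by (subst sum.swap) simp
  finally show ?thesis
    by (simp add: real_average_def sum_divide_distrib sum_distrib_left)
qed

lemma multiple_ergodic_average_cauchy:
  fixes f :: "nat \<Rightarrow> 'a \<Rightarrow> complex"
  assumes f: "\<And>i. f i \<in> borel_measurable M" and bound: "\<And>i x. norm (f i x) \<le> C" and e: "e > 0"
  shows "\<exists>n0. \<forall>m\<ge>n0. \<forall>n\<ge>n0.
    (\<integral>x. (norm (multiple_ergodic_average l T f m x - multiple_ergodic_average l T f n x))\<^sup>2 \<partial>M) \<le> e"
proof -
  define h where "h S i x = (if i \<in> S then Re (f i x) else Im (f i x))" for S i x
  let ?P = "Pow {1..l}" and ?d = "\<lambda>S m n x. real_average l (h S) m x - real_average l (h S) n x"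
  let ?A = "multiple_ergodic_average l T f"
  have h: "h S i \<in> borel_measurable M" "\<bar>h S i x\<bar> \<le> C" for S i x
    using f[of i] order_trans[OF abs_Re_le_cmod bound] order_trans[OF abs_Im_le_cmod bound]
    by (cases "i \<in> S"; simp add: h_def[abs_def])+
  have rb: "real_average l (h S) n \<in> borel_measurable M" "\<bar>real_average l (h S) n x\<bar> \<le> C ^ l" for S n x
    by (rule real_average_bounded[OF h])+
  have int: "integrable M (\<lambda>x. (?d S m n x)\<^sup>2)" for S m n
  proof (rule integrable_const_bound[of _ "(2 * C ^ l)\<^sup>2"])
    have "\<bar>?d S m n x\<bar> \<le> 2 * C ^ l" for x
      using rb(2)[of S m x] rb(2)[of S n x] by linarith
    then have "\<bar>?d S m n x\<bar>\<^sup>2 \<le> (2 * C ^ l)\<^sup>2" for x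
      by (rule power_mono) simp
    then show "AE x in M. norm ((?d S m n x)\<^sup>2) \<le> (2 * C ^ l)\<^sup>2"
      by (intro AE_I2) (simp only: real_norm_def power2_abs abs_power2)
  qed (use rb(1) in simp)
  have le: "(\<integral>x. (norm (?A m x - ?A n x))\<^sup>2 \<partial>M) \<le> 2 ^ l * (\<Sum>S\<in>?P. \<integral>x. (?d S m n x)\<^sup>2 \<partial>M)" for m n
  proof -
    have "(norm (?A m x - ?A n x))\<^sup>2 \<le> (\<Sum>S\<in>?P. (?d S m n x)\<^sup>2) * 2 ^ l" for x
    proof -
      have "?A m x - ?A n x = (\<Sum>S\<in>?P. \<i> ^ card ({1..l} - S) * of_real (?d S m n x))"
        unfolding multiple_ergodic_average_expand h_def
        by (simp add: right_diff_distrib sum_subtractf)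
      then have "norm (?A m x - ?A n x) \<le> (\<Sum>S\<in>?P. \<bar>?d S m n x\<bar>)"
        by (simp only:) (rule order_trans[OF norm_sum], simp add: norm_mult norm_power flip: of_real_diff)
      then have "(norm (?A m x - ?A n x))\<^sup>2 \<le> (\<Sum>S\<in>?P. \<bar>?d S m n x\<bar>)\<^sup>2"
        by (rule power_mono) simp
      also have "\<dots> \<le> (\<Sum>S\<in>?P. \<bar>?d S m n x\<bar>\<^sup>2) * card ?P"
        by (rule sum_squared_le_sum_of_squares)
      finally show ?thesis by (simp add: card_Pow)
    qed
    then have "(\<integral>x. (norm (?A m x - ?A n x))\<^sup>2 \<partial>M) \<le> (\<integral>x. (\<Sum>S\<in>?P. (?d S m n x)\<^sup>2) * 2 ^ l \<partial>M)"
      by (intro integral_mono') (auto intro!: int sum_nonneg mult_nonneg_nonneg)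
    then show ?thesis by (simp add: int mult.commute)
  qed
  \<comment> \<open>One factor \<open>2 ^ l\<close> of \<open>4 ^ l\<close> pays for the number of
    sets \<open>S\<close>, the other for Cauchy-Schwarz over them.\<close>
  have "\<forall>S. \<exists>n0. \<forall>m\<ge>n0. \<forall>n\<ge>n0. (\<integral>x. (?d S m n x)\<^sup>2 \<partial>M) \<le> e / 4 ^ l"
    by (intro allI real_average_cauchy[OF h]) (use e in simp)
  from choice[OF this] obtain n0 where
    n0: "\<And>S m n. m \<ge> n0 S \<Longrightarrow> n \<ge> n0 S \<Longrightarrow> (\<integral>x. (?d S m n x)\<^sup>2 \<partial>M) \<le> e / 4 ^ l"
    by blast
  have "(\<integral>x. (norm (?A m x - ?A n x))\<^sup>2 \<partial>M) \<le> e" if mn: "m \<ge> Max (n0 ` ?P)" "n \<ge> Max (n0 ` ?P)" for m n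
  proof -
    have "(\<Sum>S\<in>?P. \<integral>x. (?d S m n x)\<^sup>2 \<partial>M) \<le> (\<Sum>S\<in>?P. e / 4 ^ l)"
    proof (intro sum_mono n0)
      fix S assume "S \<in> ?P"
      then have "n0 S \<le> Max (n0 ` ?P)" by (intro Max_ge) auto
      with mn show "n0 S \<le> m" "n0 S \<le> n" by simp_all
    qed
    also have "\<dots> = e / 2 ^ l"
    proof -
      have "(4::real) ^ l = 2 ^ l * 2 ^ l" by (simp flip: power_mult_distrib)
      then show ?thesis by (simp add: card_Pow)
    qed
    finally have "2 ^ l * (\<Sum>S\<in>?P. \<integral>x. (?d S m n x)\<^sup>2 \<partial>M) \<le> e"
      by (simp add: field_simps)
    with le[of m n] show ?thesis by linarith
  qed
  then show ?thesis by blast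
qed

lemma multiple_ergodic_average_measurable:
  fixes f :: "nat \<Rightarrow> 'a \<Rightarrow> complex"
  assumes f: "\<And>i. f i \<in> borel_measurable M"
  shows "multiple_ergodic_average l T f n \<in> borel_measurable M"
proof -
  have [measurable]: "(\<lambda>x. f i ((T i ^^ p) x)) \<in> borel_measurable M" for i p
    by (rule measurable_compose[OF T_power(1) f])
  show ?thesis
    unfolding multiple_ergodic_average_def[abs_def] by measurable
qed

lemma multiple_ergodic_average_convergent:
  fixes f :: "nat \<Rightarrow> 'a \<Rightarrow> complex"
  assumes f: "\<And>i. f i \<in> borel_measurable M" and bound: "\<And>i x. norm (f i x) \<le> C"
  obtains g where "g \<in> borel_measurable M" "AE x in M. norm (g x) \<le> C ^ l"
    "(\<lambda>n. \<integral>x. (norm (multiple_ergodic_average l T f n x - g x))\<^sup>2 \<partial>M) \<longlonglongrightarrow> 0"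
proof (rule bounded_L2_Cauchy_convergent)
  show "multiple_ergodic_average l T f n \<in> borel_measurable M" for n
    by (rule multiple_ergodic_average_measurable[OF f])
  show "norm (multiple_ergodic_average l T f n x) \<le> C ^ l" for n x
    by (rule norm_multiple_ergodic_average_le[OF bound])
  show "\<exists>n0. \<forall>m\<ge>n0. \<forall>n\<ge>n0. (\<integral>x. (norm (multiple_ergodic_average l T f m x
      - multiple_ergodic_average l T f n x))\<^sup>2 \<partial>M) \<le> e" if "e > 0" for e
    by (rule multiple_ergodic_average_cauchy[OF f bound that])
qed (rule that)

end

section \<open>Passage to maps on the space and essentially bounded functions\<close>

theorem theorem1p1:
  fixes M :: "'a measure"
    and l :: nat
    and T :: "nat \<Rightarrow> 'a \<Rightarrow> 'a"
    and f :: "nat \<Rightarrow> 'a \<Rightarrow> complex"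
  assumes "prob_space M"
    and "l \<ge> 1"
    and "\<And>i. i \<in> {1..l} \<Longrightarrow> invertible_on M (T i)"
    and "\<And>i. i \<in> {1..l} \<Longrightarrow> measure_preserving_on M (T i)"
    and "\<And>i j x. i \<in> {1..l} \<Longrightarrow> j \<in> {1..l} \<Longrightarrow> x \<in> space M \<Longrightarrow> T i (T j x) = T j (T i x)"
    and "\<And>i. i \<in> {1..l} \<Longrightarrow> f i \<in> L_infinity M"
  shows "converges_in_L_two M (multiple_ergodic_average l T f)"
proof -
  interpret prob_space M by fact
  obtain U where U: "bounded_limit U"
    using ex_filter_bounded_convergent by (metis bounded_limit.intro)
  from U interpret internal_prob_space M U
    by (simp add: internal_prob_space_def prob_space_axioms)
  have "\<forall>i. \<exists>S. i \<in> {1..l} \<longrightarrow> S \<in> measurable M M \<and> (\<forall>x\<in>space M. S (T i x) = x \<and> T i (S x) = x)"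
    using assms(3) unfolding invertible_on_def by blast
  then obtain S where S: "\<And>i. i \<in> {1..l} \<Longrightarrow> S i \<in> measurable M M"
    and ST: "\<And>i x. i \<in> {1..l} \<Longrightarrow> x \<in> space M \<Longrightarrow> S i (T i x) = x"
    and TS: "\<And>i x. i \<in> {1..l} \<Longrightarrow> x \<in> space M \<Longrightarrow> T i (S i x) = x"
    by metis
  have T: "T i \<in> measurable M M" if "i \<in> {1..l}" for i
    using assms(4)[OF that] by (simp add: measure_preserving_on_def)
  \<comment> \<open>Replacing the maps by the identity off \<open>space M\<close> and for the
    remaining indices makes all identities of \<open>commuting_system\<close> hold
    everywhere.\<close>
  define T' where "T' i x = (if i \<in> {1..l} \<and> x \<in> space M then T i x else x)" for i x
  define R' where "R' i x = (if i \<in> {1..l} \<and> x \<in> space M then S i x else x)" for i x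
  have T'_eq: "T' i x = (if i \<in> {1..l} then T i x else x)" if "x \<in> space M" for i x
    using that by (simp add: T'_def)
  interpret commuting_system M U T' R'
  proof
    fix i j x
    show T'_meas: "T' i \<in> measurable M M"
    proof (cases "i \<in> {1..l}")
      case True
      have "T' i \<in> measurable M M \<longleftrightarrow> T i \<in> measurable M M"
        by (rule measurable_cong) (use True in \<open>auto simp: T'_eq\<close>)
      with T True show ?thesis by simp
    next
      case False
      then have "T' i = (\<lambda>x. x)" by (auto simp: T'_def)
      then show ?thesis by simp
    qed
    show "R' i \<in> measurable M M"
    proof (cases "i \<in> {1..l}")
      case True
      have "R' i \<in> measurable M M \<longleftrightarrow> S i \<in> measurable M M"
        by (rule measurable_cong) (use True in \<open>auto simp: R'_def\<close>)
      with S True show ?thesis by simp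
    next
      case False
      then have "R' i = (\<lambda>x. x)" by (auto simp: R'_def)
      then show ?thesis by simp
    qed
    show "distr M M (T' i) = M"
    proof (rule measure_eqI)
      fix A assume "A \<in> sets (distr M M (T' i))"
      then have A: "A \<in> sets M" by simp
      have "emeasure M (T' i -` A \<inter> space M) = emeasure M A"
      proof (cases "i \<in> {1..l}")
        case True
        then have "T' i -` A \<inter> space M = T i -` A \<inter> space M" by (auto simp: T'_def)
        with assms(4)[OF True] A show ?thesis by (simp add: measure_preserving_on_def)
      next
        case False
        then have "T' i -` A \<inter> space M = A" using sets.sets_into_space[OF A] by (auto simp: T'_def)
        then show ?thesis by simp
      qed
      then show "emeasure (distr M M (T' i)) A = emeasure M A"
        using A T'_meas by (simp add: emeasure_distr)
    qed simp
    show "R' i (T' i x) = x"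
      using ST measurable_space[OF T] by (auto simp: T'_def R'_def)
    show "T' i (R' i x) = x"
      using TS measurable_space[OF S] by (auto simp: T'_def R'_def)
    show "T' i (T' j x) = T' j (T' i x)"
      using assms(5) measurable_space[OF T] by (auto simp: T'_def)
  qed
  have "\<forall>i. \<exists>C. i \<in> {1..l} \<longrightarrow> (AE x in M. norm (f i x) \<le> C)"
    using assms(6) unfolding L_infinity_def by blast
  then obtain c where c: "\<And>i. i \<in> {1..l} \<Longrightarrow> AE x in M. norm (f i x) \<le> c i"
    by metis
  have f[measurable]: "f i \<in> borel_measurable M" if "i \<in> {1..l}" for i
    using assms(6)[OF that] by (simp add: L_infinity_def)
  define C where "C = (\<Sum>i=1..l. \<bar>c i\<bar>)"
  have C: "AE x in M. norm (f i x) \<le> C" if "i \<in> {1..l}" for i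
  proof -
    have "\<bar>c i\<bar> \<le> C" unfolding C_def using that by (intro member_le_sum) auto
    with c[OF that] show ?thesis by (auto elim: eventually_mono)
  qed
  have C_nonneg: "0 \<le> C" by (simp add: C_def sum_nonneg)
  \<comment> \<open>Truncation turns the essential bound into a bound at every point and changes
    each relevant function only on a null set.\<close>
  define f' where "f' i x = (if i \<in> {1..l} \<and> norm (f i x) \<le> C then f i x else 0)" for i x
  have f': "f' i \<in> borel_measurable M" for i
  proof (cases "i \<in> {1..l}")
    case True
    then have "f' i = (\<lambda>x. if norm (f i x) \<le> C then f i x else 0)" by (auto simp: f'_def)
    moreover note f[OF True, measurable]
    ultimately show ?thesis by simp
  next
    case False
    then have "f' i = (\<lambda>x. 0)" by (auto simp: f'_def)
    then show ?thesis by simp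
  qed
  have f'_le: "norm (f' i x) \<le> C" for i x
    by (simp add: f'_def C_nonneg)
  let ?A = "multiple_ergodic_average l T f" and ?A' = "multiple_ergodic_average l T' f'"
  obtain g where g: "g \<in> borel_measurable M" "AE x in M. norm (g x) \<le> C ^ l"
    "(\<lambda>n. \<integral>x. (norm (?A' n x - g x))\<^sup>2 \<partial>M) \<longlonglongrightarrow> 0"
    by (rule multiple_ergodic_average_convergent[OF f' f'_le])
  have power: "(T i ^^ n) x = (T' i ^^ n) x \<and> (T' i ^^ n) x \<in> space M"
    if "i \<in> {1..l}" "x \<in> space M" for i n x
  proof (induction n)
    case (Suc n)
    then show ?case using that measurable_space[OF T] by (simp add: T'_eq)
  qed (use that in simp)
  have f_power: "(\<lambda>x. f i ((T i ^^ n) x)) \<in> borel_measurable M" if "i \<in> {1..l}" for i n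
    by (rule measurable_compose[OF measurable_compose_n[OF T[OF that]] f[OF that]])
  have A_meas[measurable]: "?A n \<in> borel_measurable M" for n
    unfolding multiple_ergodic_average_def[abs_def]
    by (intro borel_measurable_divide borel_measurable_sum borel_measurable_prod f_power) auto
  \<comment> \<open>Powers of \<open>T' i\<close> preserve the measure, so they pull null sets back
    to null sets. With countably many \<open>n\<close> and finitely many \<open>i\<close>, one null
    set serves all averages.\<close>
  have "AE x in M. norm (f i ((T' i ^^ n) x)) \<le> C" if "i \<in> {1..l}" for i n
    by (rule AE_distrD[OF T_power(1)]) (unfold T_power(2), rule C[OF that])
  then have "AE x in M. \<forall>n. \<forall>i\<in>{1..l}. norm (f i ((T' i ^^ n) x)) \<le> C"
    by (simp add: AE_all_countable AE_finite_all)
  then have AE_eq: "AE x in M. \<forall>n. ?A n x = ?A' n x"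
    using AE_space
  proof eventually_elim
    case (elim x)
    then have "f i ((T i ^^ n) x) = f' i ((T' i ^^ n) x)" if "i \<in> {1..l}" for i n
      using that power[OF that, of x n] by (auto simp: f'_def)
    then show ?case
      by (simp add: multiple_ergodic_average_def)
  qed
  have A'_le: "norm (?A' n x) \<le> C ^ l" for n x
    by (rule norm_multiple_ergodic_average_le[OF f'_le])
  have L_two: "h \<in> L_two M" if "h \<in> borel_measurable M" "AE x in M. norm (h x) \<le> C ^ l"
    for h :: "'a \<Rightarrow> complex"
  proof -
    have "AE x in M. norm ((norm (h x))\<^sup>2) \<le> (C ^ l)\<^sup>2"
      using that(2) by eventually_elim (auto intro: power_mono)
    with that(1) have "integrable M (\<lambda>x. (norm (h x))\<^sup>2)"
      by (intro integrable_const_bound[of _ "(C ^ l)\<^sup>2"]) auto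
    with that(1) show ?thesis by (simp add: L_two_def)
  qed
  show ?thesis
    unfolding converges_in_L_two_def
  proof (intro conjI allI bexI)
    show "?A n \<in> L_two M" for n
      by (rule L_two[OF A_meas]) (use AE_eq in eventually_elim, simp add: A'_le)
    show "g \<in> L_two M" by (rule L_two[OF g(1,2)])
    have [measurable]: "?A' n \<in> borel_measurable M" for n
      by (rule multiple_ergodic_average_measurable[OF f'])
    note g(1)[measurable]
    have "(\<integral>x. (norm (?A n x - g x))\<^sup>2 \<partial>M) = (\<integral>x. (norm (?A' n x - g x))\<^sup>2 \<partial>M)" for n
      by (rule integral_cong_AE) (measurable, use AE_eq in eventually_elim, simp)
    then show "(\<lambda>n. L_two_norm M (\<lambda>x. ?A n x - g x)) \<longlonglongrightarrow> 0"
      using tendsto_real_sqrt[OF g(3)] by (simp add: L_two_norm_def)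
  qed
qed

end
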